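(* Let $w=w(x_1,\ldots,x_r)$ be a lower central word (i.e. $w=\gamma_r$ for some $r\ge 1$) or a derived word (i.e. $w=\delta_k$ for some $k\ge 0$, with $r=2^k$). If $u_1,\ldots,u_r$ are non-commutator words in pairwise disjoint sets of variables, then the word $w(u_1,\ldots,u_r)$ is concise. In particular, the word $w(x_1^{n_1},\ldots,x_r^{n_r})$ is concise whenever $n_1,\ldots,n_r\in\mathbb{Z}\smallsetminus\{0\}$.
   Context: Words are elements of the free group $F$ of countable rank on variables $x_1,x_2,\ldots$. For a word $w=w(x_1,\ldots,x_r)$ and a group $G$, $w\{G\}=\{w(g_1,\ldots,g_r)\mid g_i\in G\}$ is the set of values of $w$ in $G$, and $w(G)=\langle w\{G\}\rangle$ is the verbal subgroup. A word $w$ is concise if for every group $G$ such that $w\{G\}$ is finite, the subgroup $w(G)$ is also finite. A non-commutator word is a word lying outside $F'$; equivalently, the exponent sum of some variable in it is non-zero. Commutators are $[x,y]=x^{-1}y^{-1}xy$, and longer commutators are left-normed: $[x_1,\ldots,x_r]=[[x_1,\ldots,x_{r-1}],x_r]$. The lower central words are $\gamma_r(x_1,\ldots,x_r)=[x_1,\ldots,x_r]$ (with $\gamma_1=x_1$). The derived words are defined by $\delta_0=x_1$ and $\delta_k(x_1,\ldots,x_{2^k})=[\delta_{k-1}(x_1,\ldots,x_{2^{k-1}}),\delta_{k-1}(x_{2^{k-1}+1},\ldots,x_{2^k})]$. The word $w(u_1,\ldots,u_r)$ is obtained by substituting $u_i$ for $x_i$ in $w$. *)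

theory Defs
  imports "HOL-Algebra.Generated_Groups" "HOL-Library.Disjoint_Sets"
begin

section \<open>The free group of countable rank\<close>

text \<open>The variable numbered \<open>i\<close> plays the role of \<open>x\<close> with index \<open>i + 1\<close>. The letter
  \<open>(i, True)\<close> is this variable and \<open>(i, False)\<close> is its inverse. Elements of the free group
  are freely reduced lists of letters.\<close>

type_synonym letter = "nat \<times> bool"
type_synonym word = "letter list"

definition inv_letter :: "letter \<Rightarrow> letter" where
  "inv_letter l = (fst l, \<not> snd l)"

definition reduced :: "word \<Rightarrow> bool" where
  "reduced w \<longleftrightarrow> successively (\<lambda>a b. b \<noteq> inv_letter a) w"

text \<open>For reduced \<open>w\<close>, \<open>push l w\<close> is the reduced form of \<open>l # w\<close>.\<close>

definition push :: "letter \<Rightarrow> word \<Rightarrow> word" where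
  "push l w = (case w of [] \<Rightarrow> [l] | a # w' \<Rightarrow> if a = inv_letter l then w' else l # w)"

definition free_group :: "word monoid" where
  "free_group = \<lparr>carrier = {w. reduced w}, mult = (\<lambda>v w. foldr push v w), one = []\<rparr>"

definition var :: "nat \<Rightarrow> word" where
  "var i = [(i, True)]"

definition vars :: "word \<Rightarrow> nat set" where
  "vars w = fst ` set w"

definition non_commutator_word :: "word \<Rightarrow> bool" where
  "non_commutator_word w \<longleftrightarrow>
     w \<in> carrier free_group \<and> w \<notin> derived free_group (carrier free_group)"


section \<open>Values of words, verbal subgroups and conciseness\<close>

definition letter_value :: "('a, 'b) monoid_scheme \<Rightarrow> (nat \<Rightarrow> 'a) \<Rightarrow> letter \<Rightarrow> 'a" where
  "letter_value G g l = (if snd l then g (fst l) else inv\<^bsub>G\<^esub> g (fst l))"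

definition word_value :: "('a, 'b) monoid_scheme \<Rightarrow> word \<Rightarrow> (nat \<Rightarrow> 'a) \<Rightarrow> 'a" where
  "word_value G w g = foldr (\<lambda>l a. letter_value G g l \<otimes>\<^bsub>G\<^esub> a) w \<one>\<^bsub>G\<^esub>"

text \<open>All variables are assigned a value here, but only those occurring in the word matter,
  so this is the set of values under assignments of the finitely many variables of the word.\<close>

definition word_values :: "('a, 'b) monoid_scheme \<Rightarrow> word \<Rightarrow> 'a set" where
  "word_values G w = {word_value G w g | g. \<forall>i. g i \<in> carrier G}"

definition verbal_subgroup :: "('a, 'b) monoid_scheme \<Rightarrow> word \<Rightarrow> 'a set" where
  "verbal_subgroup G w = generate G (word_values G w)"

text \<open>HOL cannot quantify over types inside a formula, hence the type of the group elements is
  a parameter. A theorem concluding \<open>concise TYPE('a) w\<close> for a type variable \<open>'a\<close>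
  covers all groups.\<close>

definition concise :: "'a itself \<Rightarrow> word \<Rightarrow> bool" where
  "concise (_ :: 'a itself) w \<longleftrightarrow>
     (\<forall>G :: 'a monoid. group G \<longrightarrow> finite (word_values G w) \<longrightarrow> finite (verbal_subgroup G w))"

definition substitute :: "word \<Rightarrow> (nat \<Rightarrow> word) \<Rightarrow> word" where
  "substitute w u = word_value free_group w u"


section \<open>Lower central words and derived words\<close>

definition commutator :: "('a, 'b) monoid_scheme \<Rightarrow> 'a \<Rightarrow> 'a \<Rightarrow> 'a" where
  "commutator G x y = inv\<^bsub>G\<^esub> x \<otimes>\<^bsub>G\<^esub> inv\<^bsub>G\<^esub> y \<otimes>\<^bsub>G\<^esub> x \<otimes>\<^bsub>G\<^esub> y"

text \<open>Only indices \<open>r \<ge> 1\<close> are meaningful; the value at \<open>0\<close> is a dummy.\<close>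

fun lower_central_word :: "nat \<Rightarrow> word" where
  "lower_central_word 0 = \<one>\<^bsub>free_group\<^esub>"
| "lower_central_word (Suc 0) = var 0"
| "lower_central_word (Suc (Suc n)) =
     commutator free_group (lower_central_word (Suc n)) (var (Suc n))"

fun derived_word :: "nat \<Rightarrow> word" where
  "derived_word 0 = var 0"
| "derived_word (Suc k) =
     commutator free_group (derived_word k)
       (substitute (derived_word k) (\<lambda>i. var (2 ^ k + i)))"


section \<open>Basic facts\<close>

lemma inv_letter_inv_letter [simp]: "inv_letter (inv_letter l) = l"
  by (simp add: inv_letter_def)

lemma inv_letter_eq_iff: "inv_letter a = b \<longleftrightarrow> a = inv_letter b"
  by auto

lemma reduced_Nil [simp]: "reduced []"
  by (simp add: reduced_def)

lemma reduced_Cons: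
  "reduced (l # w) \<longleftrightarrow> reduced w \<and> (w = [] \<or> hd w \<noteq> inv_letter l)"
  by (auto simp: reduced_def successively_Cons)

lemma reduced_push: "reduced w \<Longrightarrow> reduced (push l w)"
  by (auto simp: push_def reduced_Cons split: list.split)

lemma reduced_foldr_push: "reduced w \<Longrightarrow> reduced (foldr push v w)"
  by (induction v) (auto simp: reduced_push)

lemma push_inv_letter: "reduced w \<Longrightarrow> push l (push (inv_letter l) w) = w"
  by (cases w) (auto simp: push_def reduced_Cons split: list.split)

lemma push_eq_Cons: "reduced (l # w) \<Longrightarrow> push l w = l # w"
  by (auto simp: push_def reduced_Cons split: list.split)

lemma foldr_push_push:
  "reduced w \<Longrightarrow> foldr push (push l v) w = push l (foldr push v w)"
proof (cases v)
  case (Cons a v')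
  assume "reduced w"
  then show ?thesis
    using Cons push_inv_letter[OF reduced_foldr_push, of w l v']
    by (auto simp: push_def[of l "a # v'"])
qed (simp add: push_def[of l "[]"])

lemma foldr_push_assoc:
  "reduced w \<Longrightarrow> foldr push (foldr push u v) w = foldr push u (foldr push v w)"
  by (induction u) (auto simp: foldr_push_push)

lemma foldr_push_Nil: "reduced v \<Longrightarrow> foldr push v [] = v"
  by (induction v) (auto simp: push_eq_Cons reduced_Cons)

lemma reduced_inverse:
  assumes "reduced v"
  shows "reduced (rev (map inv_letter v))"
  using assms unfolding reduced_def successively_rev successively_map
  by (rule successively_mono) auto

lemma foldr_push_inverse:
  assumes "reduced v"
  shows "foldr push (rev (map inv_letter v)) v = []"
  using assms by (induction v) (auto simp: reduced_Cons push_def)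

lemma carrier_free_group: "carrier free_group = {w. reduced w}"
  and mult_free_group: "v \<otimes>\<^bsub>free_group\<^esub> w = foldr push v w"
  and one_free_group: "\<one>\<^bsub>free_group\<^esub> = []"
  by (simp_all add: free_group_def)

lemma group_free_group: "group free_group"
proof (rule groupI)
  fix v
  assume "v \<in> carrier free_group"
  then show "\<exists>w\<in>carrier free_group. w \<otimes>\<^bsub>free_group\<^esub> v = \<one>\<^bsub>free_group\<^esub>"
    by (intro bexI[of _ "rev (map inv_letter v)"])
       (auto simp: carrier_free_group mult_free_group one_free_group
          foldr_push_inverse reduced_inverse)
qed (auto simp: carrier_free_group mult_free_group one_free_group reduced_foldr_push
       foldr_push_assoc)

lemma var_in_carrier: "var i \<in> carrier free_group"
  by (simp add: var_def carrier_free_group reduced_Cons)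

lemma inv_var: "inv\<^bsub>free_group\<^esub> (var i) = [(i, False)]"
proof -
  interpret group free_group by (rule group_free_group)
  have "[(i, False)] \<otimes>\<^bsub>free_group\<^esub> var i = \<one>\<^bsub>free_group\<^esub>"
    by (simp add: mult_free_group one_free_group var_def push_def inv_letter_def)
  moreover have "[(i, False)] \<in> carrier free_group"
    by (simp add: carrier_free_group reduced_Cons)
  ultimately show ?thesis
    using inv_equality var_in_carrier by blast
qed

lemma substitute_var:
  assumes "reduced w"
  shows "substitute w var = w"
  using assms
proof (induction w)
  case (Cons l w)
  have "letter_value free_group var l = [l]"
    by (cases l) (auto simp: letter_value_def inv_var inv_var[unfolded var_def] var_def)
  then show ?case
    using Cons push_eq_Cons[OF Cons.prems]
    by (simp add: substitute_def word_value_def mult_free_group reduced_Cons)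
qed (simp add: substitute_def word_value_def one_free_group)

lemma word_value_cong:
  assumes "\<And>i. i \<in> vars w \<Longrightarrow> g i = h i"
  shows "word_value G w g = word_value G w h"
  using assms by (induction w) (auto simp: word_value_def letter_value_def vars_def)

context group
begin

lemma letter_value_closed: "(\<And>i. g i \<in> carrier G) \<Longrightarrow> letter_value G g l \<in> carrier G"
  by (simp add: letter_value_def)

lemma word_value_closed: "(\<And>i. g i \<in> carrier G) \<Longrightarrow> word_value G w g \<in> carrier G"
  by (induction w) (auto simp: word_value_def letter_value_closed)

lemma word_value_push:
  assumes g: "\<And>i. g i \<in> carrier G"
  shows "word_value G (push l w) g = letter_value G g l \<otimes> word_value G w g"
proof (cases "\<exists>w'. w = inv_letter l # w'")
  case True
  then obtain w' where w: "w = inv_letter l # w'" by blast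
  have "letter_value G g l \<otimes> letter_value G g (inv_letter l) = \<one>"
    using g by (simp add: letter_value_def inv_letter_def)
  then show ?thesis
    using w m_assoc[OF letter_value_closed letter_value_closed word_value_closed,
        of g g g l "inv_letter l" w'] g word_value_closed[of g w']
    by (simp add: push_def word_value_def)
qed (auto simp: push_def word_value_def split: list.split)

lemma word_value_hom:
  assumes g: "\<And>i. g i \<in> carrier G"
  shows "(\<lambda>w. word_value G w g) \<in> hom free_group G"
proof (rule homI)
  fix v w
  show "word_value G (v \<otimes>\<^bsub>free_group\<^esub> w) g = word_value G v g \<otimes> word_value G w g"
  proof (induction v)
    case (Cons l v)
    then show ?case
      using word_value_push[of g l "foldr push v w"] g
      by (simp add: mult_free_group word_value_def[of G "l # v"] letter_value_closed
          word_value_closed m_assoc flip: word_value_def)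
  qed (use g word_value_closed in \<open>simp add: mult_free_group word_value_def[of G "[]"]\<close>)
qed (use g word_value_closed in blast)

lemma word_value_var: "g i \<in> carrier G \<Longrightarrow> word_value G (var i) g = g i"
  by (simp add: word_value_def var_def letter_value_def)

end

lemma substitute_closed:
  assumes "\<And>i. i \<in> vars w \<Longrightarrow> u i \<in> carrier free_group"
  shows "substitute w u \<in> carrier free_group"
proof -
  interpret group free_group by (rule group_free_group)
  have "word_value free_group w u =
        word_value free_group w (\<lambda>i. if i \<in> vars w then u i else \<one>\<^bsub>free_group\<^esub>)"
    by (rule word_value_cong) simp
  then show ?thesis
    using assms by (auto simp: substitute_def intro!: word_value_closed)
qed

lemma commutator_closed:
  assumes "group G" "x \<in> carrier G" "y \<in> carrier G"
  shows "commutator G x y \<in> carrier G"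
proof -
  interpret group G by fact
  show ?thesis using assms by (simp add: commutator_def)
qed

lemma lower_central_word_closed: "lower_central_word r \<in> carrier free_group"
  by (induction r rule: lower_central_word.induct)
     (auto intro!: commutator_closed group_free_group var_in_carrier
        monoid.one_closed group.is_monoid)

lemma derived_word_closed: "derived_word k \<in> carrier free_group"
  by (induction k)
     (auto intro!: commutator_closed group_free_group substitute_closed var_in_carrier)

lemma inv_free_group:
  assumes "v \<in> carrier free_group"
  shows "inv\<^bsub>free_group\<^esub> v = rev (map inv_letter v)"
proof -
  interpret group free_group by (rule group_free_group)
  show ?thesis
    using assms inv_equality[of "rev (map inv_letter v)" v]
    by (auto simp: carrier_free_group mult_free_group one_free_group
        foldr_push_inverse reduced_inverse)
qed

lemma set_push: "set (push l w) \<subseteq> insert l (set w)"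
  by (auto simp: push_def split: list.splits if_splits)

lemma vars_mult: "vars (v \<otimes>\<^bsub>free_group\<^esub> w) \<subseteq> vars v \<union> vars w"
proof -
  have "set (foldr push v w) \<subseteq> set v \<union> set w"
    by (induction v) (use set_push in fastforce)+
  then show ?thesis
    by (auto simp: vars_def mult_free_group)
qed

lemma vars_inv: "v \<in> carrier free_group \<Longrightarrow> vars (inv\<^bsub>free_group\<^esub> v) = vars v"
  by (auto simp: inv_free_group vars_def inv_letter_def image_image)

lemma vars_commutator:
  assumes "v \<in> carrier free_group" "w \<in> carrier free_group"
  shows "vars (commutator free_group v w) \<subseteq> vars v \<union> vars w"
  using vars_mult vars_inv[OF assms(1)] vars_inv[OF assms(2)]
  unfolding commutator_def by blast

lemma vars_substitute:
  assumes "\<And>i. u i \<in> carrier free_group"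
  shows "vars (substitute w u) \<subseteq> (\<Union>i\<in>vars w. vars (u i))"
proof (induction w)
  case (Cons l w)
  have "vars (letter_value free_group u l) = vars (u (fst l))"
    using assms by (simp add: letter_value_def vars_inv)
  moreover have "substitute (l # w) u =
      letter_value free_group u l \<otimes>\<^bsub>free_group\<^esub> substitute w u"
    by (simp add: substitute_def word_value_def)
  moreover have "vars (l # w) = insert (fst l) (vars w)"
    by (simp add: vars_def)
  ultimately show ?case
    using vars_mult[of "letter_value free_group u l" "substitute w u"] Cons by auto
qed (simp add: substitute_def word_value_def one_free_group vars_def)

text \<open>The following two facts show that the substituted words with index \<open>\<ge> r\<close> are
  irrelevant in \<open>substitute w u\<close> when \<open>w\<close> is a lower central or derived word in
  \<open>r\<close> variables.\<close>

lemma vars_lower_central_word: "vars (lower_central_word r) \<subseteq> {..<r}"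
proof (induction r rule: lower_central_word.induct)
  case (3 n)
  have "vars (lower_central_word (Suc (Suc n))) \<subseteq>
      vars (lower_central_word (Suc n)) \<union> vars (var (Suc n))"
    by (simp add: vars_commutator lower_central_word_closed var_in_carrier)
  moreover have "vars (var (Suc n)) = {Suc n}"
    by (simp add: vars_def var_def)
  ultimately show ?case using 3 by fastforce
qed (auto simp: one_free_group vars_def var_def)

lemma vars_derived_word: "vars (derived_word k) \<subseteq> {..<2 ^ k}"
proof (induction k)
  case (Suc k)
  let ?d = "substitute (derived_word k) (\<lambda>i. var (2 ^ k + i))"
  have "vars (derived_word (Suc k)) \<subseteq> vars (derived_word k) \<union> vars ?d"
    by (simp add: vars_commutator derived_word_closed substitute_closed var_in_carrier)
  moreover have "vars ?d \<subseteq> (\<Union>i\<in>vars (derived_word k). {2 ^ k + i})"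
    using vars_substitute[of "\<lambda>i. var (2 ^ k + i)" "derived_word k"]
    by (simp add: var_in_carrier) (simp add: vars_def var_def)
  ultimately show ?case using Suc by fastforce
qed (simp add: vars_def var_def)

end

theory Submission
  imports Defs "HOL-Algebra.FiniteProduct"
begin

text \<open>The argument works for every outer commutator word, that is, for every binary tree of
  commutators in distinct variables. The values of a non-commutator word form a normal subset
  containing all \<open>e\<close>-th powers for some \<open>e > 0\<close>; substitute such subsets for the variables.
  The key fact is that a homomorphism from the verbal subgroup to a torsion-free abelian group
  is trivial as soon as it takes finitely many values on the set of word values: an expression
  that is multiplicative in a power \<open>g\<^sup>k\<^sup>e\<close> of an entry and takes finitely many values is
  trivial, and multiplicativity is obtained by induction over the tree.

  If the set \<open>F\<close> of word values is finite, its centralizer in \<open>V = \<langle>F\<rangle>\<close> has finite index, so the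
  transfer maps \<open>V\<close> to its centre. Modulo torsion this homomorphism is trivial, so the elements of
  \<open>F\<close> have finite order, and \<open>V\<close> is finite by Dietzmann's lemma.\<close>

section \<open>Commutator trees\<close>

datatype comm_tree = Leaf nat | Node comm_tree comm_tree

fun leaves :: "comm_tree \<Rightarrow> nat set" where
  "leaves (Leaf i) = {i}"
| "leaves (Node s t) = leaves s \<union> leaves t"

fun comm_values :: "('a, 'b) monoid_scheme \<Rightarrow> (nat \<Rightarrow> 'a set) \<Rightarrow> comm_tree \<Rightarrow> 'a set" where
  "comm_values G S (Leaf i) = S i"
| "comm_values G S (Node s t) =
     {commutator G x y | x y. x \<in> comm_values G S s \<and> y \<in> comm_values G S t}"

text \<open>The union runs over all positions of the one leaf that is filled from \<open>A\<close>.
  With \<open>A\<close> the verbal subgroup, these values are shown to vanish first, and the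
  deviations from multiplicativity are then reduced to them.\<close>

fun comm_values_one ::
  "('a, 'b) monoid_scheme \<Rightarrow> (nat \<Rightarrow> 'a set) \<Rightarrow> 'a set \<Rightarrow> comm_tree \<Rightarrow> 'a set" where
  "comm_values_one G S A (Leaf i) = A"
| "comm_values_one G S A (Node s t) =
     {commutator G x y | x y. x \<in> comm_values_one G S A s \<and> y \<in> comm_values G S t} \<union>
     {commutator G x y | x y. x \<in> comm_values G S s \<and> y \<in> comm_values_one G S A t}"

definition conj_by :: "('a, 'b) monoid_scheme \<Rightarrow> 'a \<Rightarrow> 'a \<Rightarrow> 'a" where
  "conj_by G g x = inv\<^bsub>G\<^esub> g \<otimes>\<^bsub>G\<^esub> x \<otimes>\<^bsub>G\<^esub> g"

definition normal_set :: "('a, 'b) monoid_scheme \<Rightarrow> 'a set \<Rightarrow> bool" where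
  "normal_set G X \<longleftrightarrow> X \<subseteq> carrier G \<and> (\<forall>g\<in>carrier G. \<forall>x\<in>X. conj_by G g x \<in> X)"

text \<open>This is what non-commutator words contribute: one exponent that serves for all group
  elements.\<close>

definition contains_powers :: "('a, 'b) monoid_scheme \<Rightarrow> 'a set \<Rightarrow> bool" where
  "contains_powers G X \<longleftrightarrow> (\<exists>e>0. \<forall>g\<in>carrier G. g [^]\<^bsub>G\<^esub> (e::nat) \<in> X)"

definition torsion_free :: "('a, 'b) monoid_scheme \<Rightarrow> bool" where
  "torsion_free G \<longleftrightarrow> (\<forall>x\<in>carrier G. \<forall>n>0. x [^]\<^bsub>G\<^esub> (n::nat) = \<one>\<^bsub>G\<^esub> \<longrightarrow> x = \<one>\<^bsub>G\<^esub>)"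

context group
begin

section \<open>Identities for commutators and conjugates\<close>

lemma inv_mult_cancel_left: "x \<in> carrier G \<Longrightarrow> y \<in> carrier G \<Longrightarrow> inv x \<otimes> (x \<otimes> y) = y"
  by (simp flip: m_assoc)

lemma mult_inv_cancel_left: "x \<in> carrier G \<Longrightarrow> y \<in> carrier G \<Longrightarrow> x \<otimes> (inv x \<otimes> y) = y"
  by (simp flip: m_assoc)

text \<open>Rewriting with these brings group words into right-associated, freely reduced form, so
  that commutator identities become syntactic equalities.\<close>

lemmas word_simps = commutator_def conj_by_def m_assoc inv_mult_group
  inv_mult_cancel_left mult_inv_cancel_left

lemma commutator_in_carrier [simp]:
  "x \<in> carrier G \<Longrightarrow> y \<in> carrier G \<Longrightarrow> commutator G x y \<in> carrier G"
  by (simp add: commutator_def)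

lemma conj_by_closed [simp]:
  "x \<in> carrier G \<Longrightarrow> g \<in> carrier G \<Longrightarrow> conj_by G g x \<in> carrier G"
  by (simp add: conj_by_def)

lemma conj_by_mult:
  "\<lbrakk>x \<in> carrier G; y \<in> carrier G; g \<in> carrier G\<rbrakk>
     \<Longrightarrow> conj_by G g (x \<otimes> y) = conj_by G g x \<otimes> conj_by G g y"
  by (simp add: word_simps)

lemma conj_by_inv:
  "\<lbrakk>x \<in> carrier G; g \<in> carrier G\<rbrakk> \<Longrightarrow> conj_by G g (inv x) = inv (conj_by G g x)"
  by (simp add: word_simps)

lemma conj_by_conj_by:
  "\<lbrakk>x \<in> carrier G; g \<in> carrier G; h \<in> carrier G\<rbrakk>
     \<Longrightarrow> conj_by G h (conj_by G g x) = conj_by G (g \<otimes> h) x"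
  by (simp add: word_simps)

lemma conj_by_commutator:
  "\<lbrakk>x \<in> carrier G; y \<in> carrier G; g \<in> carrier G\<rbrakk>
     \<Longrightarrow> conj_by G g (commutator G x y) = commutator G (conj_by G g x) (conj_by G g y)"
  by (simp add: word_simps)

lemma conj_by_eq_mult_commutator:
  "\<lbrakk>x \<in> carrier G; g \<in> carrier G\<rbrakk> \<Longrightarrow> conj_by G g x = x \<otimes> commutator G x g"
  by (simp add: word_simps)

lemma commutator_eq_inv_mult_conj_by:
  "\<lbrakk>x \<in> carrier G; g \<in> carrier G\<rbrakk> \<Longrightarrow> commutator G x g = inv x \<otimes> conj_by G g x"
  by (simp add: word_simps)

lemma inv_commutator:
  "\<lbrakk>x \<in> carrier G; y \<in> carrier G\<rbrakk> \<Longrightarrow> inv (commutator G x y) = commutator G y x"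
  by (simp add: word_simps)

lemma commutator_mult_left:
  "\<lbrakk>x \<in> carrier G; y \<in> carrier G; z \<in> carrier G\<rbrakk>
     \<Longrightarrow> commutator G (x \<otimes> y) z = conj_by G y (commutator G x z) \<otimes> commutator G y z"
  by (simp add: word_simps)

lemma commutator_mult_right:
  "\<lbrakk>x \<in> carrier G; y \<in> carrier G; z \<in> carrier G\<rbrakk>
     \<Longrightarrow> commutator G x (y \<otimes> z) = commutator G x z \<otimes> conj_by G z (commutator G x y)"
  by (simp add: word_simps)

lemma commutator_inv_left:
  "\<lbrakk>x \<in> carrier G; y \<in> carrier G\<rbrakk>
     \<Longrightarrow> commutator G (inv x) y = conj_by G (inv x) (inv (commutator G x y))"
  by (simp add: word_simps)

lemma Hall_Witt:
  assumes [simp]: "x \<in> carrier G" "y \<in> carrier G" "z \<in> carrier G"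
  shows "conj_by G y (commutator G (commutator G x (inv y)) z) \<otimes>
         conj_by G z (commutator G (commutator G y (inv z)) x) \<otimes>
         conj_by G x (commutator G (commutator G z (inv x)) y) = \<one>"
  by (simp add: word_simps)

section \<open>Normal subsets and the subgroups they generate\<close>

lemma normal_setI:
  "X \<subseteq> carrier G \<Longrightarrow> (\<And>g x. g \<in> carrier G \<Longrightarrow> x \<in> X \<Longrightarrow> conj_by G g x \<in> X) \<Longrightarrow> normal_set G X"
  by (simp add: normal_set_def)

lemma normal_set_generate:
  assumes "normal_set G X"
  shows "normal_set G (generate G X)"
proof (rule normal_setI)
  have X: "X \<subseteq> carrier G" using assms by (simp add: normal_set_def)
  show *: "generate G X \<subseteq> carrier G" using X by (rule generate_incl)
  fix g x assume g: "g \<in> carrier G" and "x \<in> generate G X"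
  from this(2) show "conj_by G g x \<in> generate G X"
  proof induction
    case one
    then show ?case using g generate.one by (simp add: conj_by_def)
  next
    case (incl h)
    then show ?case using g assms by (simp add: normal_set_def generate.incl)
  next
    case (inv h)
    then show ?case using g assms X
      by (metis conj_by_inv generate.inv normal_set_def subsetD)
  next
    case (eng h1 h2)
    then show ?case using g * by (simp add: conj_by_mult generate.eng subset_iff)
  qed
qed

lemma normal_set_commutators:
  assumes "normal_set G X" "normal_set G Y"
  shows "normal_set G {commutator G x y | x y. x \<in> X \<and> y \<in> Y}"
  using assms by (fastforce simp: normal_set_def subset_iff conj_by_commutator)

lemma normal_set_Un: "normal_set G X \<Longrightarrow> normal_set G Y \<Longrightarrow> normal_set G (X \<union> Y)"
  by (auto simp: normal_set_def)

lemma normal_set_comm_values: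
  assumes "\<And>i. i \<in> leaves t \<Longrightarrow> normal_set G (S i)"
  shows "normal_set G (comm_values G S t)"
  using assms by (induction t) (simp_all add: normal_set_commutators)

lemma normal_set_comm_values_one:
  assumes "\<And>i. i \<in> leaves t \<Longrightarrow> normal_set G (S i)" "normal_set G A"
  shows "normal_set G (comm_values_one G S A t)"
  using assms
  by (induction t)
     (simp_all add: normal_set_commutators normal_set_Un normal_set_comm_values)

text \<open>Expanding \<open>[h1 h2, y]\<close> and \<open>[inv h, y]\<close> produces conjugates of
  commutators with \<open>y\<close> and their inverses, which the normal subgroup \<open>W\<close>
  absorbs.\<close>

lemma subgroup_commutator_left:
  assumes W: "subgroup W G" "normal_set G W" and y: "y \<in> carrier G"
    and X: "X \<subseteq> carrier G" "\<And>x. x \<in> X \<Longrightarrow> commutator G x y \<in> W"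
    and x: "x \<in> generate G X"
  shows "commutator G x y \<in> W"
proof -
  interpret W: subgroup W G by fact
  have conj: "conj_by G g w \<in> W" if "w \<in> W" "g \<in> carrier G" for w g
    using W that by (simp add: normal_set_def)
  show ?thesis using x
  proof induction
    case one
    then show ?case using y by (simp add: commutator_def)
  next
    case (incl h)
    then show ?case using X by simp
  next
    case (inv h)
    then show ?case using X(1) X(2)[OF inv] y
      by (simp add: commutator_inv_left conj subset_iff)
  next
    case (eng h1 h2)
    then have "h1 \<in> carrier G" "h2 \<in> carrier G" using X generate_in_carrier by blast+
    then show ?case using eng y by (simp add: commutator_mult_left conj)
  qed
qed

lemma commutator_swap_mem:
  assumes "subgroup W G" "x \<in> carrier G" "y \<in> carrier G"
  shows "commutator G x y \<in> W \<longleftrightarrow> commutator G y x \<in> W"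
  using assms by (metis inv_commutator subgroup.m_inv_closed)

text \<open>One argument is treated at a time. Swapping the arguments inverts a commutator, so the
  lemma for the left argument serves for both.\<close>

lemma commutator_generate_mem:
  assumes W: "subgroup W G" "normal_set G W"
    and X: "X \<subseteq> carrier G" and Y: "Y \<subseteq> carrier G"
    and XY: "\<And>x y. x \<in> X \<Longrightarrow> y \<in> Y \<Longrightarrow> commutator G x y \<in> W"
    and x: "x \<in> generate G X" and y: "y \<in> generate G Y"
  shows "commutator G x y \<in> W"
proof -
  have "commutator G x' y \<in> W" if "x' \<in> X" for x'
  proof -
    have "commutator G y x' \<in> W"
      using W subsetD[OF X that] Y _ y
    proof (rule subgroup_commutator_left)
      show "commutator G y' x' \<in> W" if "y' \<in> Y" for y'
        using XY[OF \<open>x' \<in> X\<close> that] X Y \<open>x' \<in> X\<close> that commutator_swap_mem[OF W(1)] by blast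
    qed
    then show ?thesis
      using X Y that y generate_in_carrier commutator_swap_mem[OF W(1)] by blast
  qed
  then show ?thesis
    using subgroup_commutator_left[OF W _ X _ x] generate_in_carrier[OF Y y] by blast
qed

text \<open>Induction over the tree, by the three subgroup argument: the Hall--Witt identity moves the
  entry from \<open>A\<close> to one of the two branches.\<close>

lemma commutator_mem_generate_one:
  assumes S: "\<And>i. i \<in> leaves t \<Longrightarrow> normal_set G (S i)"
    and A: "subgroup A G" "normal_set G A"
    and a: "a \<in> A" and y: "y \<in> generate G (comm_values G S t)"
  shows "commutator G a y \<in> generate G (comm_values_one G S A t)"
  using S a y
proof (induction t arbitrary: a y)
  case (Leaf i)
  interpret A: subgroup A G by (rule A)
  have y: "y \<in> carrier G"
    using Leaf.prems generate_in_carrier[of "S i"] by (auto simp: normal_set_def)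
  have "commutator G a y \<in> A"
    using A Leaf.prems y by (auto simp: commutator_eq_inv_mult_conj_by normal_set_def)
  then show ?case by (simp add: generate.incl)
next
  case (Node s t)
  interpret A: subgroup A G by (rule A)
  let ?X = "comm_values G S s" and ?Y = "comm_values G S t"
  let ?X1 = "comm_values_one G S A s" and ?Y1 = "comm_values_one G S A t"
  define W where "W = generate G (comm_values_one G S A (Node s t))"
  have nX: "normal_set G ?X" "normal_set G ?Y" "normal_set G ?X1" "normal_set G ?Y1"
    using Node.prems(1) A by (auto intro!: normal_set_comm_values normal_set_comm_values_one)
  then have X: "?X \<subseteq> carrier G" "?Y \<subseteq> carrier G" "?X1 \<subseteq> carrier G" "?Y1 \<subseteq> carrier G"
    by (auto simp: normal_set_def)
  have nW1: "normal_set G (comm_values_one G S A (Node s t))"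
    using Node.prems(1) A by (intro normal_set_comm_values_one)
  have W: "subgroup W G" "normal_set G W"
    using nW1 normal_set_generate[OF nW1] generate_is_subgroup
    by (simp_all add: W_def normal_set_def del: comm_values_one.simps)
  interpret W: subgroup W G by (rule W)
  have conj: "conj_by G g w \<in> W" if "w \<in> W" "g \<in> carrier G" for w g
    using W that by (simp add: normal_set_def)
  have base: "x \<in> ?X1 \<Longrightarrow> y \<in> ?Y \<Longrightarrow> commutator G x y \<in> W"
    "x \<in> ?X \<Longrightarrow> y \<in> ?Y1 \<Longrightarrow> commutator G x y \<in> W" for x y
    unfolding W_def by (rule generate.incl, auto)+
  have X1Y: "commutator G u v \<in> W" if "u \<in> generate G ?X1" "v \<in> generate G ?Y" for u v
    using commutator_generate_mem[OF W X(3,2) base(1) that] .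
  have Y1X: "commutator G v u \<in> W" if "u \<in> generate G ?X" "v \<in> generate G ?Y1" for u v
  proof -
    have "commutator G u v \<in> W"
      using commutator_generate_mem[OF W X(1,4) base(2) that] .
    moreover have "u \<in> carrier G" "v \<in> carrier G"
      using that X generate_in_carrier by blast+
    ultimately show ?thesis
      using commutator_swap_mem[OF W(1), of u v] by simp
  qed
  \<comment> \<open>The Hall-Witt identity for \<open>p\<close>, \<open>inv q\<close>,
    \<open>b\<close> has a conjugate of \<open>[[p, q], b]\<close> as its first factor. In the two
    other factors \<open>b\<close> or its inverse is first commuted with an element of a single
    branch, so the induction hypotheses place them in \<open>W\<close>.\<close>
  have key: "commutator G (commutator G p q) b \<in> W" if p: "p \<in> ?X" and q: "q \<in> ?Y" and b: "b \<in> A" for p q b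
  proof -
    note [simp] = subsetD[OF X(1) p] subsetD[OF X(2) q] A.mem_carrier[OF b]
    have gp: "inv p \<in> generate G ?X" "p \<in> generate G ?X"
      "inv q \<in> generate G ?Y"
      using p q by (auto intro: generate.intros)
    have "commutator G b (inv p) \<in> generate G ?X1"
      using Node.IH(1)[of b "inv p"] Node.prems(1) b gp by simp
    then have 1: "conj_by G p (commutator G (commutator G b (inv p)) (inv q)) \<in> W"
      using X1Y gp by (intro conj) auto
    \<comment> \<open>The factor needed is \<open>[inv q, inv b]\<close>, the inverse of this
      commutator; hence \<open>inv b\<close> in place of \<open>b\<close>.\<close>
    have "commutator G (inv b) (inv q) \<in> generate G ?Y1"
      using Node.IH(2)[of "inv b" "inv q"] Node.prems(1) b gp by simp
    then have "inv (commutator G (inv b) (inv q)) \<in> generate G ?Y1"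
      using X(4) generate_m_inv_closed by blast
    then have "commutator G (inv q) (inv b) \<in> generate G ?Y1"
      by (simp add: inv_commutator)
    then have 2: "conj_by G b (commutator G (commutator G (inv q) (inv b)) p) \<in> W"
      using Y1X gp by (intro conj) auto
    define c where "c = commutator G (commutator G p q) b"
    have [simp]: "c \<in> carrier G" by (simp add: c_def)
    have "conj_by G (inv q) c \<otimes>
          conj_by G b (commutator G (commutator G (inv q) (inv b)) p) \<otimes>
          conj_by G p (commutator G (commutator G b (inv p)) (inv q)) = \<one>"
      using Hall_Witt[of p "inv q" b] by (simp add: c_def)
    then have "conj_by G (inv q) c \<otimes>
          (conj_by G b (commutator G (commutator G (inv q) (inv b)) p) \<otimes>
          conj_by G p (commutator G (commutator G b (inv p)) (inv q))) = \<one>"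
      by (simp add: m_assoc)
    then have "conj_by G (inv q) c = inv (conj_by G b (commutator G (commutator G (inv q) (inv b)) p) \<otimes>
          conj_by G p (commutator G (commutator G b (inv p)) (inv q)))"
      by (intro inv_equality[symmetric]) auto
    then have "conj_by G (inv q) c \<in> W"
      using 1 2 by simp
    then have "conj_by G q (conj_by G (inv q) c) \<in> W"
      by (rule conj) simp
    then show ?thesis by (simp add: conj_by_conj_by) (simp add: conj_by_def c_def)
  qed
  have "commutator G v a \<in> W" if "v \<in> comm_values G S (Node s t)" for v
    using that key Node.prems(2) by auto
  moreover have carr: "comm_values G S (Node s t) \<subseteq> carrier G"
    using normal_set_comm_values[OF Node.prems(1)] by (simp only: normal_set_def)
  ultimately have "commutator G y a \<in> W"
    using subgroup_commutator_left[OF W A.mem_carrier[OF Node.prems(2)] _ _ Node.prems(3)]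
    by blast
  moreover have "y \<in> carrier G"
    using Node.prems(3) carr generate_in_carrier by blast
  ultimately show ?case
    using Node.prems(2) commutator_swap_mem[OF W(1), of y a] by (simp add: W_def)
qed

end

section \<open>Homomorphisms to torsion-free abelian groups\<close>

text \<open>By pigeonhole two of the powers with exponents \<open>k * e\<close> coincide, so
  \<open>h\<close> has finite order.\<close>

lemma torsion_free_eq_one:
  assumes "group H" "torsion_free H" and h: "h \<in> carrier H" and e: "e > 0"
    and fin: "finite F" and F: "\<And>k::nat. h [^]\<^bsub>H\<^esub> (k * e) \<in> F"
  shows "h = \<one>\<^bsub>H\<^esub>"
proof -
  interpret H: group H by fact
  have "\<not> inj (\<lambda>k::nat. h [^]\<^bsub>H\<^esub> (k * e))"
    using F fin by (metis finite_imageD finite_subset image_subsetI infinite_UNIV_nat)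
  then obtain k l where kl: "k < l" "h [^]\<^bsub>H\<^esub> (k * e) = h [^]\<^bsub>H\<^esub> (l * e)"
    unfolding inj_def by (metis linorder_neqE_nat)
  then have "h [^]\<^bsub>H\<^esub> (l * e - k * e) = \<one>\<^bsub>H\<^esub>"
    using h H.pow_eq_div2[of h "l * e" "k * e"] by simp
  moreover have "l * e - k * e > 0" using kl e by simp
  ultimately show ?thesis using assms(2) h unfolding torsion_free_def by blast
qed

text \<open>Finiteness is asked on \<open>V\<close> only, not on the subgroup it generates: for
  finite \<open>V\<close> every homomorphism qualifies, and the condition survives when one argument
  of a commutator is frozen.\<close>

definition finite_homs ::
  "('a, 'c) monoid_scheme \<Rightarrow> ('b, 'd) monoid_scheme \<Rightarrow> 'a set \<Rightarrow> ('a \<Rightarrow> 'b) set" where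
  "finite_homs G H V = {\<phi> \<in> hom (G\<lparr>carrier := generate G V\<rparr>) H. finite (\<phi> ` V)}"

locale finite_homs_setting = group G + H: comm_group H
  for G :: "('a, 'c) monoid_scheme" (structure) and H :: "('b, 'd) monoid_scheme" +
  fixes V :: "'a set"
  assumes normal_V: "normal_set G V"
begin

abbreviation "N \<equiv> generate G V"
abbreviation "\<Phi> \<equiv> finite_homs G H V"

lemma V_subset: "V \<subseteq> carrier G"
  using normal_V by (simp add: normal_set_def)

lemma N_subgroup: "subgroup N G"
  using V_subset by (rule generate_is_subgroup)

sublocale N: subgroup N G
  by (rule N_subgroup)

lemma normal_N: "normal_set G N"
  using normal_V by (rule normal_set_generate)

lemma conj_by_N: "n \<in> N \<Longrightarrow> g \<in> carrier G \<Longrightarrow> conj_by G g n \<in> N"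
  using normal_N by (simp add: normal_set_def)

lemma commutator_N:
  assumes "n \<in> N" "g \<in> carrier G"
  shows "commutator G n g \<in> N" "commutator G g n \<in> N"
proof -
  show "commutator G n g \<in> N"
    using assms by (simp add: commutator_eq_inv_mult_conj_by conj_by_N)
  then show "commutator G g n \<in> N"
    using assms commutator_swap_mem[OF N_subgroup, of n g] by simp
qed

section \<open>Homomorphisms with finitely many values on \<open>V\<close>\<close>

lemma hom_group_hom: "\<phi> \<in> \<Phi> \<Longrightarrow> group_hom (G\<lparr>carrier := N\<rparr>) H \<phi>"
  by (simp add: finite_homs_def group_hom_def group_hom_axioms_def subgroup_imp_group[OF N_subgroup])

lemma hom_closed: "\<phi> \<in> \<Phi> \<Longrightarrow> n \<in> N \<Longrightarrow> \<phi> n \<in> carrier H"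
  using hom_group_hom group_hom.hom_closed by fastforce

lemma hom_mult: "\<phi> \<in> \<Phi> \<Longrightarrow> m \<in> N \<Longrightarrow> n \<in> N \<Longrightarrow> \<phi> (m \<otimes> n) = \<phi> m \<otimes>\<^bsub>H\<^esub> \<phi> n"
  using hom_group_hom[of \<phi>] group_hom.hom_mult[of "G\<lparr>carrier := N\<rparr>" H \<phi> m n] by simp

lemma hom_one: "\<phi> \<in> \<Phi> \<Longrightarrow> \<phi> \<one> = \<one>\<^bsub>H\<^esub>"
  using hom_group_hom[of \<phi>] group_hom.hom_one[of "G\<lparr>carrier := N\<rparr>" H \<phi>] by simp

lemma hom_inv: "\<phi> \<in> \<Phi> \<Longrightarrow> n \<in> N \<Longrightarrow> \<phi> (inv n) = inv\<^bsub>H\<^esub> \<phi> n"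
  using hom_group_hom[of \<phi>] group_hom.hom_inv[of "G\<lparr>carrier := N\<rparr>" H \<phi> n]
    m_inv_consistent[OF N_subgroup] by simp

lemma hom_nat_pow:
  assumes "\<phi> \<in> \<Phi>" "n \<in> N"
  shows "\<phi> (n [^] (k::nat)) = \<phi> n [^]\<^bsub>H\<^esub> k"
proof -
  have "n [^] k \<in> N" for k :: nat using assms by (induction k) auto
  then show ?thesis using assms by (induction k) (simp_all add: hom_one hom_mult)
qed

lemma hom_conj_by:
  assumes "\<phi> \<in> \<Phi>" "m \<in> N" "n \<in> N"
  shows "\<phi> (conj_by G n m) = \<phi> m"
  using assms hom_closed[OF assms(1)]
  by (simp add: conj_by_def hom_mult hom_inv H.m_ac H.l_inv H.r_inv)

lemma homI:
  assumes "\<And>n. n \<in> N \<Longrightarrow> \<phi> n \<in> carrier H"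
    "\<And>m n. m \<in> N \<Longrightarrow> n \<in> N \<Longrightarrow> \<phi> (m \<otimes> n) = \<phi> m \<otimes>\<^bsub>H\<^esub> \<phi> n" "finite (\<phi> ` V)"
  shows "\<phi> \<in> \<Phi>"
  using assms by (simp add: finite_homs_def hom_def)

lemma hom_finite: "\<phi> \<in> \<Phi> \<Longrightarrow> finite (\<phi> ` V)"
  by (simp add: finite_homs_def)

text \<open>Since \<open>H\<close> is abelian, \<open>\<phi>\<close> ignores the conjugation in
  \<open>[m n, g] = [m, g]^n [n, g]\<close>, which gives multiplicativity. On \<open>V\<close> the
  image is finite because \<open>[v, g] = v^-1 v^g\<close>, where \<open>v\<close> and
  \<open>v^g\<close> both lie in the normal set \<open>V\<close>.\<close>

lemma hom_commutator_left:
  assumes \<phi>: "\<phi> \<in> \<Phi>" and g: "g \<in> carrier G"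
  shows "(\<lambda>n. \<phi> (commutator G n g)) \<in> \<Phi>"
proof (rule homI)
  fix m n assume "m \<in> N" "n \<in> N"
  then show "\<phi> (commutator G (m \<otimes> n) g) = \<phi> (commutator G m g) \<otimes>\<^bsub>H\<^esub> \<phi> (commutator G n g)"
    using \<phi> g by (simp add: commutator_mult_left hom_mult hom_conj_by conj_by_N commutator_N)
next
  have "(\<lambda>n. \<phi> (commutator G n g)) ` V \<subseteq> (\<lambda>(u, v). inv\<^bsub>H\<^esub> u \<otimes>\<^bsub>H\<^esub> v) ` (\<phi> ` V \<times> \<phi> ` V)"
  proof
    fix z assume "z \<in> (\<lambda>n. \<phi> (commutator G n g)) ` V"
    then obtain v where v: "v \<in> V" "z = \<phi> (commutator G v g)" by blast
    have "v \<in> N" using v by (simp add: generate.incl)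
    then have "z = inv\<^bsub>H\<^esub> \<phi> v \<otimes>\<^bsub>H\<^esub> \<phi> (conj_by G g v)"
      using v g \<phi> by (simp add: commutator_eq_inv_mult_conj_by hom_mult hom_inv conj_by_N)
    moreover have "conj_by G g v \<in> V" using normal_V v g by (simp add: normal_set_def)
    ultimately show "z \<in> (\<lambda>(u, v). inv\<^bsub>H\<^esub> u \<otimes>\<^bsub>H\<^esub> v) ` (\<phi> ` V \<times> \<phi> ` V)"
      using v(1) by (intro image_eqI[of _ _ "(\<phi> v, \<phi> (conj_by G g v))"]) auto
  qed
  then show "finite ((\<lambda>n. \<phi> (commutator G n g)) ` V)"
    by (rule finite_subset) (simp add: hom_finite[OF \<phi>])
qed (use \<phi> g in \<open>simp add: hom_closed commutator_N\<close>)

text \<open>This is the pointwise inverse of the map in the left-hand version, again a homomorphism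
  because \<open>H\<close> is abelian.\<close>

lemma hom_commutator_right:
  assumes \<phi>: "\<phi> \<in> \<Phi>" and g: "g \<in> carrier G"
  shows "(\<lambda>n. \<phi> (commutator G g n)) \<in> \<Phi>"
proof -
  let ?\<psi> = "\<lambda>n. \<phi> (commutator G n g)"
  have \<psi>: "?\<psi> \<in> \<Phi>" by (rule hom_commutator_left[OF assms])
  have eq: "\<phi> (commutator G g n) = inv\<^bsub>H\<^esub> ?\<psi> n" if "n \<in> N" for n
    using that \<phi> g by (simp add: inv_commutator commutator_N flip: hom_inv)
  have "(\<lambda>n. \<phi> (commutator G g n)) ` V = (\<lambda>h. inv\<^bsub>H\<^esub> h) ` ?\<psi> ` V"
    using eq generate.incl[of _ V G] by (force simp: image_image)
  then have "finite ((\<lambda>n. \<phi> (commutator G g n)) ` V)"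
    using hom_finite[OF \<psi>] by simp
  then show ?thesis
    using eq hom_closed[OF \<psi>] hom_mult[OF \<psi>]
    by (intro homI) (simp_all add: H.inv_mult)
qed

text \<open>A value with one entry \<open>a\<close> in \<open>A\<close> is \<open>c a\<close>, where \<open>c\<close> is an iterated commutator with all
  other entries frozen. Commuting with a fixed element of \<open>G\<close> preserves \<open>\<Phi>\<close>, hence so does \<open>c\<close>.\<close>

lemma comm_values_one_context:
  assumes "\<And>i. i \<in> leaves t \<Longrightarrow> normal_set G (S i) \<and> contains_powers G (S i)"
    and A: "A \<subseteq> carrier G" "normal_set G A"
    and "z \<in> comm_values_one G S A t"
  shows "\<exists>c. \<exists>a\<in>A. \<exists>e>0. z = c a \<and> (\<forall>g\<in>carrier G. c (g [^] (e::nat)) \<in> comm_values G S t) \<and>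
           (\<forall>\<phi>\<in>\<Phi>. (\<lambda>n. \<phi> (c n)) \<in> \<Phi>)"
  using assms(1,4)
proof (induction t arbitrary: z)
  case (Leaf i)
  then show ?case
    by (intro exI[of _ "\<lambda>x. x"] bexI[of _ z]) (auto simp: contains_powers_def)
next
  case (Node s t)
  have carr: "comm_values G S s \<subseteq> carrier G" "comm_values G S t \<subseteq> carrier G"
    using normal_set_comm_values[of s S] normal_set_comm_values[of t S] Node.prems(1)
    by (auto simp: normal_set_def)
  consider (left) x y where "z = commutator G x y" "x \<in> comm_values_one G S A s" "y \<in> comm_values G S t"
    | (right) x y where "z = commutator G x y" "x \<in> comm_values G S s" "y \<in> comm_values_one G S A t"
    using Node.prems(2) by auto
  then show ?case
  proof cases
    case left
    then obtain c a e where c: "a \<in> A" "e > 0" "x = c a"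
      "\<forall>g\<in>carrier G. c (g [^] (e::nat)) \<in> comm_values G S s" "\<forall>\<phi>\<in>\<Phi>. (\<lambda>n. \<phi> (c n)) \<in> \<Phi>"
      using Node.IH(1)[of x] Node.prems(1) by auto
    \<comment> \<open>The outermost commutator comes first: \<open>n \<mapsto> \<phi> [n, y]\<close>
      is in \<open>\<Phi>\<close>, and the induction hypothesis for \<open>c\<close> applies to this
      map in place of \<open>\<phi>\<close>.\<close>
    have "(\<lambda>n. \<phi> (commutator G (c n) y)) \<in> \<Phi>" if "\<phi> \<in> \<Phi>" for \<phi>
      using bspec[OF c(5) hom_commutator_left[OF that subsetD[OF carr(2) left(3)]]] .
    then show ?thesis
      using c left
      by (intro exI[of _ "\<lambda>u. commutator G (c u) y"] bexI[of _ a] exI[of _ e]) auto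
  next
    case right
    then obtain c a e where c: "a \<in> A" "e > 0" "y = c a"
      "\<forall>g\<in>carrier G. c (g [^] (e::nat)) \<in> comm_values G S t" "\<forall>\<phi>\<in>\<Phi>. (\<lambda>n. \<phi> (c n)) \<in> \<Phi>"
      using Node.IH(2)[of y] Node.prems(1) by auto
    have "(\<lambda>n. \<phi> (commutator G x (c n))) \<in> \<Phi>" if "\<phi> \<in> \<Phi>" for \<phi>
      using bspec[OF c(5) hom_commutator_right[OF that subsetD[OF carr(1) right(2)]]] .
    then show ?thesis
      using c right
      by (intro exI[of _ "\<lambda>u. commutator G x (c u)"] bexI[of _ a] exI[of _ e]) auto
  qed
qed

lemma comm_values_one_subset_N:
  assumes "\<And>i. i \<in> leaves t \<Longrightarrow> normal_set G (S i)"
  shows "comm_values_one G S N t \<subseteq> N"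
  using assms
proof (induction t)
  case (Node s t)
  have "comm_values G S s \<subseteq> carrier G" "comm_values G S t \<subseteq> carrier G"
    using normal_set_comm_values[of s S] normal_set_comm_values[of t S] Node.prems
    by (auto simp: normal_set_def)
  then show ?case
    using Node by (auto simp: commutator_N subset_iff)
qed simp

text \<open>With all other entries frozen, \<open>\<phi>\<close> of the value is multiplicative in
  the entry \<open>a\<close>. Replacing \<open>a\<close> by its \<open>k * e\<close>-th power gives
  an element of \<open>V\<close>, so the \<open>k * e\<close>-th powers of \<open>\<phi> z\<close>
  stay in a finite set, and torsion-freeness applies.\<close>

lemma hom_comm_values_one:
  assumes S: "\<And>i. i \<in> leaves t \<Longrightarrow> normal_set G (S i) \<and> contains_powers G (S i)"
    and V: "V = comm_values G S t" and H: "torsion_free H"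
    and z: "z \<in> comm_values_one G S N t" and \<phi>: "\<phi> \<in> \<Phi>"
  shows "\<phi> z = \<one>\<^bsub>H\<^esub>"
proof -
  obtain c a e where c: "a \<in> N" "e > 0" "z = c a"
    "\<forall>g\<in>carrier G. c (g [^] (e::nat)) \<in> V" "\<forall>\<phi>\<in>\<Phi>. (\<lambda>n. \<phi> (c n)) \<in> \<Phi>"
    using comm_values_one_context[OF S N.subset normal_N z] V by blast
  have \<psi>: "(\<lambda>n. \<phi> (c n)) \<in> \<Phi>" using c \<phi> by blast
  have "\<phi> (c a) [^]\<^bsub>H\<^esub> (k * e) \<in> \<phi> ` V" for k
  proof -
    have "\<phi> (c a) [^]\<^bsub>H\<^esub> (k * e) = \<phi> (c ((a [^] k) [^] e))"
      using hom_nat_pow[OF \<psi> c(1), of "k * e"] c(1) by (simp add: nat_pow_pow)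
    then show ?thesis using c by simp
  qed
  then show ?thesis
    using torsion_free_eq_one[OF H.group_axioms H hom_closed[OF \<psi> c(1)] c(2) hom_finite[OF \<phi>]] c(3)
    by blast
qed

section \<open>The common kernel of \<open>\<Phi>\<close>\<close>

definition "R = {n \<in> N. \<forall>\<phi>\<in>\<Phi>. \<phi> n = \<one>\<^bsub>H\<^esub>}"

lemma R_mem_N: "r \<in> R \<Longrightarrow> r \<in> N"
  by (simp add: R_def)

lemma hom_R: "r \<in> R \<Longrightarrow> \<phi> \<in> \<Phi> \<Longrightarrow> \<phi> r = \<one>\<^bsub>H\<^esub>"
  unfolding R_def by blast

lemma RI: "r \<in> N \<Longrightarrow> (\<And>\<phi>. \<phi> \<in> \<Phi> \<Longrightarrow> \<phi> r = \<one>\<^bsub>H\<^esub>) \<Longrightarrow> r \<in> R"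
  by (simp add: R_def)

lemma R_subgroup: "subgroup R G"
proof (rule subgroupI)
  show "R \<noteq> {}" using RI[of \<one>] hom_one by auto
  show "R \<subseteq> carrier G" using R_mem_N by auto
  show "inv a \<in> R" if "a \<in> R" for a
    using that by (intro RI) (simp_all add: R_mem_N hom_inv hom_R)
  show "a \<otimes> b \<in> R" if "a \<in> R" "b \<in> R" for a b
    using that by (intro RI) (simp_all add: R_mem_N hom_mult hom_R)
qed

text \<open>Here \<open>r^g = r [r, g]\<close>, and \<open>n \<mapsto> \<phi> [n, g]\<close> is
  again in \<open>\<Phi>\<close>. This closure property is the reason for intersecting the kernels
  of all of \<open>\<Phi>\<close> instead of using a single one.\<close>

lemma normal_R: "normal_set G R"
proof (rule normal_setI)
  show "R \<subseteq> carrier G" using R_mem_N by auto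
  fix g r assume g: "g \<in> carrier G" and r: "r \<in> R"
  show "conj_by G g r \<in> R"
  proof (rule RI)
    fix \<phi> assume \<phi>: "\<phi> \<in> \<Phi>"
    then show "\<phi> (conj_by G g r) = \<one>\<^bsub>H\<^esub>"
      using hom_R[OF r \<phi>] hom_R[OF r hom_commutator_left[OF \<phi> g]] R_mem_N[OF r] g
      by (simp add: conj_by_eq_mult_commutator hom_mult commutator_N)
  qed (use g r in \<open>simp add: R_mem_N conj_by_N\<close>)
qed

lemma hom_trivial_on_N:
  assumes "\<phi> \<in> \<Phi>" "\<And>v. v \<in> V \<Longrightarrow> \<phi> v = \<one>\<^bsub>H\<^esub>" "n \<in> N"
  shows "\<phi> n = \<one>\<^bsub>H\<^esub>"
  using assms(3)
proof induction
  case (inv h)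
  then show ?case using assms by (simp add: hom_inv generate.incl)
qed (use assms in \<open>simp_all add: hom_one hom_mult\<close>)

end

context group
begin

text \<open>For a node with branches \<open>X\<close> and \<open>Y\<close>, the common kernel \<open>R\<close> of \<open>\<Phi>\<close> contains the values with
  an entry in \<open>N\<close>, so \<open>[N, Y, X] \<le> R\<close>. Hence \<open>[x, y, a]\<close> is multiplicative in \<open>y\<close> modulo \<open>R\<close>, and
  induction on the branch \<open>Y\<close> yields \<open>[N, X] \<le> R\<close>. Now \<open>[x, y]\<close> is multiplicative in \<open>x\<close> modulo \<open>R\<close>,
  and induction on the branch \<open>X\<close> applies.\<close>

theorem finite_hom_comm_values_trivial:
  assumes H: "comm_group H" "torsion_free H"
    and S: "\<And>i. i \<in> leaves t \<Longrightarrow> normal_set G (S i) \<and> contains_powers G (S i)"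
    and \<phi>: "\<phi> \<in> finite_homs G H (comm_values G S t)"
    and x: "x \<in> comm_values G S t"
  shows "\<phi> x = \<one>\<^bsub>H\<^esub>"
  using S \<phi> x
proof (induction t arbitrary: \<phi> x)
  case (Leaf i)
  interpret H: comm_group H by (rule H)
  interpret finite_homs_setting G H "S i"
    using Leaf.prems(1) by unfold_locales auto
  obtain e where e: "e > 0" "\<And>g. g \<in> carrier G \<Longrightarrow> g [^] (e::nat) \<in> S i"
    using Leaf.prems(1) by (auto simp: contains_powers_def)
  have \<phi>: "\<phi> \<in> finite_homs G H (S i)" and "x \<in> S i"
    using Leaf.prems by auto
  then have x: "x \<in> N" by (simp add: generate.incl)
  have "\<phi> x [^]\<^bsub>H\<^esub> (k * e) \<in> \<phi> ` S i" for k
  proof -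
    have "\<phi> x [^]\<^bsub>H\<^esub> (k * e) = \<phi> ((x [^] k) [^] e)"
      using hom_nat_pow[OF \<phi> x, of "k * e"] x by (simp add: nat_pow_pow)
    then show ?thesis using e x by simp
  qed
  then show ?case
    using torsion_free_eq_one[OF H.group_axioms H(2) hom_closed[OF \<phi> x] e(1) hom_finite[OF \<phi>]]
    by blast
next
  case (Node s t)
  let ?X = "comm_values G S s" and ?Y = "comm_values G S t"
  interpret H: comm_group H by (rule H)
  interpret finite_homs_setting G H "comm_values G S (Node s t)"
    by unfold_locales (use Node.prems(1) normal_set_comm_values[of "Node s t" S] in blast)
  have nX: "normal_set G ?X" "normal_set G ?Y"
    using Node.prems(1) by (auto intro!: normal_set_comm_values)
  interpret X: finite_homs_setting G H ?X by unfold_locales (rule nX)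
  interpret Y: finite_homs_setting G H ?Y by unfold_locales (rule nX)
  note R = R_subgroup normal_R
  have XY: "commutator G a b \<in> comm_values G S (Node s t)" if "a \<in> ?X" "b \<in> ?Y" for a b
    using that by auto
  note [simp del] = comm_values.simps(2)
  have XYN: "commutator G a b \<in> N" if "a \<in> X.N" "b \<in> Y.N" for a b
    using commutator_generate_mem[OF N_subgroup normal_N X.V_subset Y.V_subset _ that] XY
    by (simp add: generate.incl)
  have oneR: "z \<in> R" if "z \<in> comm_values_one G S N (Node s t)" for z
  proof (rule RI)
    show "z \<in> N" using that comm_values_one_subset_N[of "Node s t" S] Node.prems(1) by blast
    show "\<psi> z = \<one>\<^bsub>H\<^esub>" if "\<psi> \<in> \<Phi>" for \<psi>
      using hom_comm_values_one[OF Node.prems(1) refl H(2) \<open>z \<in> comm_values_one _ _ _ _\<close> that] .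
  qed
  \<comment> \<open>By the three subgroup argument \<open>[n, b]\<close> is a product of values of
    \<open>t\<close> with one entry in \<open>N\<close> and of their inverses. Commuting such a
    value with \<open>a\<close> gives, up to inversion, a value of the whole tree with one entry in
    \<open>N\<close>.\<close>
  have NYX: "commutator G (commutator G n b) a \<in> R" if n: "n \<in> N" and a: "a \<in> ?X" and b: "b \<in> Y.N" for n a b
  proof -
    have "commutator G n b \<in> generate G (comm_values_one G S N t)"
      using Node.prems(1) n b
      by (intro commutator_mem_generate_one N_subgroup normal_N) auto
    moreover have "comm_values_one G S N t \<subseteq> N"
      using Node.prems(1) by (intro comm_values_one_subset_N) auto
    moreover have "commutator G z a \<in> R" if z: "z \<in> comm_values_one G S N t" for z
    proof -
      have "commutator G a z \<in> R"
        using a z by (intro oneR) auto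
      moreover have "z \<in> carrier G" "a \<in> carrier G"
        using z a \<open>comm_values_one G S N t \<subseteq> N\<close> X.V_subset by auto
      ultimately show ?thesis using commutator_swap_mem[OF R(1), of z a] by simp
    qed
    ultimately show ?thesis
      using subgroup_commutator_left[OF R, of a "comm_values_one G S N t"] a X.V_subset N.subset
      by blast
  qed
  have hX: "\<psi> (commutator G n a) = \<one>\<^bsub>H\<^esub>" if \<psi>: "\<psi> \<in> \<Phi>" and a: "a \<in> ?X" and n: "n \<in> N" for \<psi> a n
  proof -
    let ?\<chi> = "\<lambda>n. \<psi> (commutator G n a)"
    have aG: "a \<in> carrier G" using a X.V_subset by blast
    have \<chi>: "?\<chi> \<in> \<Phi>" by (rule hom_commutator_left[OF \<psi> aG])
    have "?\<chi> (commutator G b y) = \<one>\<^bsub>H\<^esub>" if b: "b \<in> ?X" and y: "y \<in> ?Y" for b y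
    proof -
      have bX: "b \<in> X.N" using b by (rule generate.incl)
      let ?\<theta> = "\<lambda>y. ?\<chi> (commutator G b y)"
      have "?\<theta> \<in> Y.\<Phi>"
      proof (rule Y.homI)
        show "?\<theta> y \<in> carrier H" if "y \<in> Y.N" for y
          using hom_closed[OF \<chi>] XYN[OF bX that] .
        show "?\<theta> (y \<otimes> z) = ?\<theta> y \<otimes>\<^bsub>H\<^esub> ?\<theta> z" if y: "y \<in> Y.N" and z: "z \<in> Y.N" for y z
        proof -
          let ?c = "commutator G b y"
          have c: "?c \<in> N" using XYN[OF bX y] .
          \<comment> \<open>The only error term in multiplicativity: unfolding
            \<open>?\<chi>\<close> gives \<open>\<psi> [[c, z], a]\<close> with \<open>c\<close> in
            \<open>N\<close>, which vanishes by the inclusion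
            \<open>[N, Y, X] \<le> R\<close>.\<close>
          have "?\<chi> (commutator G ?c z) = \<one>\<^bsub>H\<^esub>"
            using hom_R[OF NYX[OF c a z] \<psi>] .
          moreover have "?\<theta> (y \<otimes> z) =
              ?\<chi> (commutator G b z \<otimes> (?c \<otimes> commutator G ?c z))"
            using y z bX c by (simp add: commutator_mult_right conj_by_eq_mult_commutator)
          moreover have "\<dots> = ?\<theta> z \<otimes>\<^bsub>H\<^esub> (?\<theta> y \<otimes>\<^bsub>H\<^esub> ?\<chi> (commutator G ?c z))"
            using hom_mult[OF \<chi>, of "commutator G b z" "?c \<otimes> commutator G ?c z"]
              hom_mult[OF \<chi>, of ?c "commutator G ?c z"] c XYN[OF bX z] z
            by (simp add: commutator_N)
          ultimately show ?thesis
            using hom_closed[OF \<chi> c] hom_closed[OF \<chi> XYN[OF bX z]] by (simp add: H.m_comm)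
        qed
        have "?\<theta> ` ?Y \<subseteq> ?\<chi> ` comm_values G S (Node s t)"
          using XY[OF b] by blast
        then show "finite (?\<theta> ` ?Y)"
          using hom_finite[OF \<chi>] finite_subset by blast
      qed
      then show ?thesis
        using Node.IH(2)[of ?\<theta> y] Node.prems(1) y by simp
    qed
    then show ?thesis
      by (intro hom_trivial_on_N[OF \<chi> _ n]) (auto simp: comm_values.simps(2))
  qed
  have NX: "commutator G n a \<in> R" if n: "n \<in> N" and a: "a \<in> X.N" for n a
  proof -
    have "commutator G m b \<in> R" if "m \<in> N" "b \<in> ?X" for m b
      using that X.V_subset by (intro RI) (auto simp: hX commutator_N)
    then show ?thesis
      using commutator_generate_mem[OF R N.subset X.V_subset _ generate.incl[OF n] a] by blast
  qed
  obtain a b where ab: "x = commutator G a b" "a \<in> ?X" "b \<in> ?Y"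
    using Node.prems(3) by (auto simp: comm_values.simps(2))
  have bY: "b \<in> Y.N" using ab by (simp add: generate.incl)
  have \<phi>: "\<phi> \<in> \<Phi>" by (rule Node.prems(2))
  let ?\<theta> = "\<lambda>a. \<phi> (commutator G a b)"
  have "?\<theta> \<in> X.\<Phi>"
  proof (rule X.homI)
    show "?\<theta> y \<in> carrier H" if "y \<in> X.N" for y
      using hom_closed[OF \<phi>] XYN[OF that bY] .
    show "?\<theta> (y \<otimes> z) = ?\<theta> y \<otimes>\<^bsub>H\<^esub> ?\<theta> z" if y: "y \<in> X.N" and z: "z \<in> X.N" for y z
    proof -
      let ?c = "commutator G y b"
      have c: "?c \<in> N" using XYN[OF y bY] .
      \<comment> \<open>Now the left entry varies, and the error term \<open>[[y, b], z]\<close> is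
        covered by the inclusion \<open>[N, X] \<le> R\<close>.\<close>
      have cz: "commutator G ?c z \<in> R" using NX[OF c z] .
      have "?\<theta> (y \<otimes> z) = \<phi> ((?c \<otimes> commutator G ?c z) \<otimes> commutator G z b)"
        using y z bY c by (simp add: commutator_mult_left conj_by_eq_mult_commutator)
      also have "\<dots> = (?\<theta> y \<otimes>\<^bsub>H\<^esub> \<phi> (commutator G ?c z)) \<otimes>\<^bsub>H\<^esub> ?\<theta> z"
        using hom_mult[OF \<phi>, of "?c \<otimes> commutator G ?c z" "commutator G z b"]
          hom_mult[OF \<phi> c R_mem_N[OF cz]] c XYN[OF z bY] R_mem_N[OF cz]
        by simp
      finally show ?thesis
        using hom_closed[OF \<phi> c] hom_R[OF cz \<phi>] by simp
    qed
    have "?\<theta> ` ?X \<subseteq> \<phi> ` comm_values G S (Node s t)"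
      using XY[OF _ ab(3)] by blast
    then show "finite (?\<theta> ` ?X)"
      using hom_finite[OF \<phi>] finite_subset by blast
  qed
  then show ?case
    using Node.IH(1)[of ?\<theta> a] Node.prems(1) ab by simp
qed

end

section \<open>Transfer and Dietzmann's lemma\<close>

lemma (in comm_group) torsion_subgroup:
  "subgroup {x \<in> carrier G. \<exists>n>0. x [^] (n::nat) = \<one>} G"
proof (rule subgroupI)
  show "{x \<in> carrier G. \<exists>n>0. x [^] (n::nat) = \<one>} \<noteq> {}"
    by (auto intro!: exI[of _ \<one>])
  fix a assume a: "a \<in> {x \<in> carrier G. \<exists>n>0. x [^] (n::nat) = \<one>}"
  then show "inv a \<in> {x \<in> carrier G. \<exists>n>0. x [^] (n::nat) = \<one>}"
    by (auto simp: nat_pow_inv)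
  fix b assume b: "b \<in> {x \<in> carrier G. \<exists>n>0. x [^] (n::nat) = \<one>}"
  obtain m n where mn: "m > 0" "a [^] (m::nat) = \<one>" "n > 0" "b [^] (n::nat) = \<one>"
    using a b by auto
  have "(a \<otimes> b) [^] (m * n) = a [^] (m * n) \<otimes> b [^] (n * m)"
    using a b by (simp add: pow_mult_distrib m_comm mult.commute)
  also have "\<dots> = \<one>"
    using a b mn by (simp flip: nat_pow_pow)
  finally show "a \<otimes> b \<in> {x \<in> carrier G. \<exists>n>0. x [^] (n::nat) = \<one>}"
    using a b mn by (auto intro!: exI[of _ "m * n"])
qed auto

lemma (in comm_group) torsion_free_quotient:
  assumes T: "T = {x \<in> carrier G. \<exists>n>0. x [^] (n::nat) = \<one>}"
  shows "torsion_free (G Mod T)"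
  unfolding torsion_free_def
proof (intro ballI allI impI)
  fix y and n :: nat
  assume y: "y \<in> carrier (G Mod T)" and n: "n > 0" and eq: "y [^]\<^bsub>G Mod T\<^esub> n = \<one>\<^bsub>G Mod T\<^esub>"
  have sub: "subgroup T G" unfolding T by (rule torsion_subgroup)
  interpret T: normal T G
    using sub by (simp add: normal_iff_subgroup)
  obtain x where x: "x \<in> carrier G" "y = T #> x"
    using y by (auto simp: carrier_FactGroup)
  have "T #> (x [^] n) = T"
    using eq x by (simp add: T.FactGroup_pow)
  then have "x [^] n \<in> T"
    using x sub by (metis nat_pow_closed rcos_self)
  then obtain m where "m > 0" "(x [^] n) [^] (m::nat) = \<one>"
    unfolding T by blast
  then have "x [^] (n * m) = \<one>" "n * m > 0"
    using x n by (simp_all add: nat_pow_pow)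
  then have "x \<in> T"
    using x(1) unfolding T by blast
  then show "y = \<one>\<^bsub>G Mod T\<^esub>"
    using x sub by (simp add: coset_join2)
qed

section \<open>Finiteness of subgroups generated by finite normal sets of torsion elements\<close>

context group
begin

text \<open>Copies of \<open>f\<close> are moved to the front by \<open>g f^j = f^j g^(f^j)\<close>.
  The factors passed over are only conjugated, so they stay in \<open>F\<close> and their number
  does not change.\<close>

lemma product_collect_power:
  assumes F: "normal_set G F" and f: "f \<in> F"
    and ws: "set ws \<subseteq> F" and j: "j \<le> count_list ws f"
  shows "\<exists>vs. set vs \<subseteq> F \<and> length vs + j = length ws \<and>
           foldr (\<otimes>) ws \<one> = f [^] j \<otimes> foldr (\<otimes>) vs \<one>"
  using ws j
proof (induction ws arbitrary: j)
  case Nil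
  then show ?case by (intro exI[of _ "[]"]) simp
next
  case (Cons g ws)
  have FG: "F \<subseteq> carrier G" using F by (simp add: normal_set_def)
  have closed: "foldr (\<otimes>) vs \<one> \<in> carrier G" if "set vs \<subseteq> F" for vs
    using that FG by (induction vs) auto
  have [simp]: "f \<in> carrier G" "g \<in> carrier G" using f FG Cons.prems by auto
  show ?case
  proof (cases "g = f \<and> j > 0")
    case True
    then obtain i where i: "j = Suc i" using gr0_conv_Suc by blast
    then obtain vs where vs: "set vs \<subseteq> F" "length vs + i = length ws"
      "foldr (\<otimes>) ws \<one> = f [^] i \<otimes> foldr (\<otimes>) vs \<one>"
      using Cons.IH[of i] Cons.prems True by auto
    then have "foldr (\<otimes>) (g # ws) \<one> = f [^] j \<otimes> foldr (\<otimes>) vs \<one>"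
      using True i closed[OF vs(1)] nat_pow_Suc2[of f i] by (simp add: m_assoc)
    then show ?thesis using vs i by auto
  next
    case False
    then have "j \<le> count_list ws f" using Cons.prems(2) by auto
    then obtain vs where vs: "set vs \<subseteq> F" "length vs + j = length ws"
      "foldr (\<otimes>) ws \<one> = f [^] j \<otimes> foldr (\<otimes>) vs \<one>"
      using Cons.IH[of j] Cons.prems by auto
    have "foldr (\<otimes>) (g # ws) \<one> = f [^] j \<otimes> foldr (\<otimes>) (conj_by G (f [^] j) g # vs) \<one>"
      using vs closed[OF vs(1)] by (simp add: conj_by_def m_assoc mult_inv_cancel_left)
    moreover have "conj_by G (f [^] j) g \<in> F"
      using F Cons.prems by (simp add: normal_set_def)
    ultimately show ?thesis
      using vs by (intro exI[of _ "conj_by G (f [^] j) g # vs"]) auto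
  qed
qed

text \<open>In a product of more than \<open>card F * m\<close> factors some \<open>f\<close> occurs
  at least \<open>m\<close> times; collecting \<open>f^m = 1\<close> in front shortens the product.
  Products without inverses suffice because \<open>inv f\<close> is \<open>f^(m - 1)\<close>. Thus
  bounded length, hence finitely many products, is enough.\<close>

lemma Dietzmann:
  assumes F: "normal_set G F" "finite F" and m: "m > 0" "\<And>f. f \<in> F \<Longrightarrow> f [^] (m::nat) = \<one>"
  shows "finite (generate G F)"
proof -
  have FG: "F \<subseteq> carrier G" using F by (simp add: normal_set_def)
  let ?P = "\<lambda>ws. foldr (\<otimes>) ws \<one>"
  let ?L = "{ws. set ws \<subseteq> F \<and> length ws \<le> card F * m}"
  have closed: "?P vs \<in> carrier G" if "set vs \<subseteq> F" for vs
    using that FG by (induction vs) auto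
  have append: "?P (us @ vs) = ?P us \<otimes> ?P vs" if "set us \<subseteq> F" "set vs \<subseteq> F" for us vs
    using that FG by (induction us) (auto simp: m_assoc closed)
  have power: "?P (replicate k f) = f [^] k" if "f \<in> F" for f and k :: nat
  proof (induction k)
    case (Suc k)
    then show ?case using that FG nat_pow_Suc2[of f k] by (simp add: subset_iff)
  qed simp
  have short: "?P ws \<in> ?P ` ?L" if "set ws \<subseteq> F" for ws
    using that
  proof (induction ws rule: length_induct)
    case (1 ws)
    show ?case
    proof (cases "length ws \<le> card F * m")
      case False
      have "\<exists>f\<in>F. m \<le> count_list ws f"
      proof (rule ccontr)
        assume "\<not> ?thesis"
        then have "(\<Sum>f\<in>F. count_list ws f) \<le> (\<Sum>f\<in>F. m)"
          by (intro sum_mono) (meson nat_le_linear)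
        moreover have "(\<Sum>f\<in>F. count_list ws f) = length ws"
          using 1 F by (intro sum_count_set) auto
        ultimately show False using False by simp
      qed
      then obtain f vs where "f \<in> F" "set vs \<subseteq> F" "length vs + m = length ws"
        "?P ws = f [^] m \<otimes> ?P vs"
        using product_collect_power[OF F(1)] 1 by meson
      then have "?P ws = ?P vs" "length vs < length ws"
        using m closed by simp_all
      then show ?thesis using 1 \<open>set vs \<subseteq> F\<close> by simp
    qed (use 1 in blast)
  qed
  have "g \<in> ?P ` {ws. set ws \<subseteq> F}" if "g \<in> generate G F" for g
    using that
  proof induction
    case one
    then show ?case by (intro image_eqI[of _ _ "[]"]) auto
  next
    case (incl h)
    then show ?case using FG by (intro image_eqI[of _ _ "[h]"]) auto
  next
    case (inv h)
    have h: "h \<in> carrier G" using inv FG by auto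
    have "h [^] (m - 1) \<otimes> h = \<one>"
      using m(1) m(2)[OF inv] nat_pow_Suc[of h "m - 1"] by simp
    then have "inv h = h [^] (m - 1)" using h by (intro inv_equality) auto
    then have "inv h = ?P (replicate (m - 1) h)" using power[OF inv] by simp
    then show ?case using inv by (intro image_eqI[of _ _ "replicate (m - 1) h"]) auto
  next
    case (eng h1 h2)
    then obtain us vs where "set us \<subseteq> F" "set vs \<subseteq> F" "h1 = ?P us" "h2 = ?P vs" by auto
    then show ?case by (intro image_eqI[of _ _ "us @ vs"]) (auto simp: append simp del: foldr_append)
  qed
  then have "generate G F \<subseteq> ?P ` ?L" using short by blast
  moreover have "finite ?L" using F(2) by (rule finite_lists_length_le)
  ultimately show ?thesis by (rule finite_surj[rotated])
qed

section \<open>The centre of \<open>generate G F\<close> and the transfer\<close>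

lemma commute_generate:
  assumes F: "F \<subseteq> carrier G" and z: "z \<in> carrier G" "\<And>f. f \<in> F \<Longrightarrow> z \<otimes> f = f \<otimes> z"
    and v: "v \<in> generate G F"
  shows "z \<otimes> v = v \<otimes> z"
  using v
proof induction
  case (inv h)
  have h: "h \<in> carrier G" using inv F by auto
  have "inv h \<otimes> (h \<otimes> z) \<otimes> inv h = inv h \<otimes> (z \<otimes> h) \<otimes> inv h" using z inv by simp
  then show ?case using h z(1) by (simp add: m_assoc inv_mult_cancel_left)
next
  case (eng h1 h2)
  then have h: "h1 \<in> carrier G" "h2 \<in> carrier G" using F generate_in_carrier by blast+
  have "z \<otimes> (h1 \<otimes> h2) = h1 \<otimes> z \<otimes> h2" using eng h z(1) by (simp flip: m_assoc)
  also have "\<dots> = h1 \<otimes> (z \<otimes> h2)" using h z(1) by (simp add: m_assoc)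
  also have "\<dots> = h1 \<otimes> h2 \<otimes> z" using eng h z(1) by (simp add: m_assoc)
  finally show ?case .
qed (use z in auto)

text \<open>The homomorphism is the transfer from \<open>generate G F\<close> to its centre, which has finite
  index because conjugation permutes the finite set \<open>F\<close>.\<close>

lemma exists_transfer:
  assumes F: "normal_set G F" "finite F"
  shows "\<exists>Z \<tau>. subgroup Z G \<and> comm_group (G\<lparr>carrier := Z\<rparr>) \<and>
           \<tau> \<in> hom (G\<lparr>carrier := generate G F\<rparr>) (G\<lparr>carrier := Z\<rparr>) \<and>
           (\<forall>v\<in>generate G F. \<exists>m>0. \<exists>k>0. \<tau> v [^] (m::nat) = v [^] (k::nat))"
proof -
  define V where "V = generate G F"
  define Z where "Z = {z \<in> V. \<forall>f\<in>F. z \<otimes> f = f \<otimes> z}"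
  \<comment> \<open>\<open>cl v\<close> is the action of \<open>v\<close> on \<open>F\<close> by
    conjugation, and restriction makes equality mean agreement on \<open>F\<close>. Its fibres on
    \<open>V\<close> are the cosets of the centre \<open>Z\<close>, so \<open>Q\<close> stands for
    the quotient and \<open>t\<close> chooses representatives.\<close>
  define cl where "cl v = restrict (conj_by G v) F" for v
  define t where "t = inv_into V cl"
  define Q where "Q = cl ` V"
  have FG: "F \<subseteq> carrier G" using F by (simp add: normal_set_def)
  have V: "subgroup V G" unfolding V_def using FG by (rule generate_is_subgroup)
  interpret V: subgroup V G by (rule V)
  have comm: "z \<otimes> v = v \<otimes> z" if "z \<in> Z" "v \<in> V" for z v
    using that commute_generate[OF FG, of z v] V.subset by (auto simp: Z_def V_def)
  have ZV: "Z \<subseteq> V" by (auto simp: Z_def)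
  have ZI: "z \<in> Z" if "z \<in> V" "\<And>f. f \<in> F \<Longrightarrow> conj_by G z f = f" for z
  proof -
    have "z \<otimes> f = f \<otimes> z" if f: "f \<in> F" for f
    proof -
      have "f \<in> carrier G" "z \<in> carrier G" using f FG \<open>z \<in> V\<close> by auto
      then have "z \<otimes> conj_by G z f = f \<otimes> z"
        by (simp add: conj_by_def m_assoc mult_inv_cancel_left)
      then show ?thesis using \<open>\<And>f. f \<in> F \<Longrightarrow> conj_by G z f = f\<close>[OF f] by simp
    qed
    then show ?thesis using that by (simp add: Z_def)
  qed
  have conjZ: "conj_by G z f = f" if "z \<in> Z" "f \<in> F" for z f
  proof -
    have "z \<in> carrier G" "f \<in> carrier G" "f \<otimes> z = z \<otimes> f"
      using that FG ZV V.subset by (auto simp: Z_def)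
    then show ?thesis by (simp add: conj_by_def m_assoc inv_mult_cancel_left)
  qed
  have Z: "subgroup Z G"
  proof (rule subgroupI)
    show "Z \<noteq> {}" using FG by (auto simp: Z_def intro!: exI[of _ \<one>])
    show "inv a \<in> Z" if "a \<in> Z" for a
    proof (rule ZI)
      have a: "a \<in> V" using that ZV by auto
      then show "inv a \<in> V" by simp
      fix f assume f: "f \<in> F"
      have "conj_by G (inv a) (conj_by G a f) = f"
      proof -
        have "a \<in> carrier G" "f \<in> carrier G" using a f FG by auto
        then show ?thesis by (simp add: conj_by_conj_by) (simp add: conj_by_def)
      qed
      then show "conj_by G (inv a) f = f" using conjZ[OF that f] by simp
    qed
    show "a \<otimes> b \<in> Z" if "a \<in> Z" "b \<in> Z" for a b
    proof (rule ZI)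
      show "a \<otimes> b \<in> V" using that ZV by auto
      fix f assume f: "f \<in> F"
      then have "conj_by G (a \<otimes> b) f = conj_by G b (conj_by G a f)"
        using that ZV FG by (subst conj_by_conj_by) auto
      then show "conj_by G (a \<otimes> b) f = f" using f that conjZ by simp
    qed
  qed (use ZV V.subset in auto)
  interpret Z: subgroup Z G by (rule Z)
  have commZ: "comm_group (G\<lparr>carrier := Z\<rparr>)"
    by (rule group.group_comm_groupI[OF subgroup_imp_group[OF Z]]) (use comm ZV in auto)
  interpret C: comm_group "G\<lparr>carrier := Z\<rparr>" by (rule commZ)
  have cl_mult: "cl (a \<otimes> b) = (\<lambda>f\<in>F. conj_by G b (cl a f))" if "a \<in> V" "b \<in> V" for a b
    unfolding cl_def using that FG by (intro restrict_ext) (auto simp: conj_by_conj_by subset_iff)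
  have cl_eqD: "a \<otimes> inv b \<in> Z" if ab: "a \<in> V" "b \<in> V" and eq: "cl a = cl b" for a b
  proof (rule ZI)
    show "a \<otimes> inv b \<in> V" using ab by simp
    fix f assume f: "f \<in> F"
    have fG: "f \<in> carrier G" and abG: "a \<in> carrier G" "b \<in> carrier G" using f FG ab by auto
    have "conj_by G a f = conj_by G b f" using fun_cong[OF eq, of f] f by (simp add: cl_def)
    then have "conj_by G (inv b) (conj_by G a f) = conj_by G (inv b) (conj_by G b f)" by simp
    then show "conj_by G (a \<otimes> inv b) f = f"
      using fG abG by (simp add: conj_by_conj_by) (simp add: conj_by_def)
  qed
  have cl_Z: "cl (a \<otimes> z) = cl a" if "a \<in> V" "z \<in> Z" for a z
    unfolding cl_mult[OF that(1) subsetD[OF ZV that(2)]] unfolding cl_def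
    using that F(1) V.subset conjZ by (intro restrict_ext) (auto simp: normal_set_def subset_iff)
  have "Q \<subseteq> F \<rightarrow>\<^sub>E F"
    using F(1) V.subset by (auto simp: Q_def cl_def normal_set_def)
  then have finQ: "finite Q"
    using F(2) by (meson finite_PiE finite_subset)
  have tV: "t q \<in> V" and cl_t: "cl (t q) = q" if "q \<in> Q" for q
    using that by (auto simp: t_def Q_def inv_into_into f_inv_into_f)
  \<comment> \<open>The classical transfer: \<open>v\<close> permutes the cosets by right
    multiplication, \<open>t q \<otimes> v = z v q \<otimes> t (\<rho> v q)\<close> with
    \<open>z v q\<close> in \<open>Z\<close>, and \<open>\<tau> v\<close> multiplies these central
    factors.\<close>
  define \<rho> where "\<rho> v q = cl (t q \<otimes> v)" for v q
  define z where "z v q = t q \<otimes> v \<otimes> inv (t (\<rho> v q))" for v q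
  define \<tau> where "\<tau> v = finprod (G\<lparr>carrier := Z\<rparr>) (z v) Q" for v
  have \<rho>Q: "\<rho> v q \<in> Q" if "v \<in> V" "q \<in> Q" for v q
    using that tV by (simp add: \<rho>_def Q_def)
  have zZ: "z v q \<in> Z" if "v \<in> V" "q \<in> Q" for v q
    unfolding z_def using that tV \<rho>Q[OF that] by (intro cl_eqD) (simp_all add: cl_t \<rho>_def)
  have \<rho>_mult: "\<rho> (v \<otimes> w) q = \<rho> w (\<rho> v q)" if "v \<in> V" "w \<in> V" "q \<in> Q" for v w q
  proof -
    have "cl (t (\<rho> v q) \<otimes> w) = cl (t q \<otimes> v \<otimes> w)"
      using that tV \<rho>Q cl_t by (simp add: cl_mult[of _ w]) (simp add: \<rho>_def)
    then show ?thesis using that tV by (simp add: \<rho>_def m_assoc)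
  qed
  have \<rho>_one: "\<rho> \<one> q = q" if "q \<in> Q" for q
    using that tV cl_t by (simp add: \<rho>_def)
  have \<rho>_inj: "inj_on (\<rho> v) Q" if v: "v \<in> V" for v
  proof (rule inj_on_inverseI)
    fix q assume "q \<in> Q"
    then show "\<rho> (inv v) (\<rho> v q) = q"
      using v \<rho>_mult[of v "inv v" q] \<rho>_one by simp
  qed
  have \<rho>_image: "\<rho> v ` Q = Q" if v: "v \<in> V" for v
    using \<rho>Q[OF v] \<rho>_inj[OF v] finQ by (intro endo_inj_surj) auto
  \<comment> \<open>This cocycle identity, with reindexing along the permutation
    \<open>\<rho> v\<close>, makes \<open>\<tau>\<close> multiplicative.\<close>
  have z_mult: "z (v \<otimes> w) q = z v q \<otimes> z w (\<rho> v q)" if v: "v \<in> V" and w: "w \<in> V" and q: "q \<in> Q" for v w q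
  proof -
    have "t q \<in> carrier G" "t (\<rho> v q) \<in> carrier G" "t (\<rho> w (\<rho> v q)) \<in> carrier G"
      using q v w tV \<rho>Q by auto
    then show ?thesis using v w q \<rho>_mult
      by (simp add: z_def m_assoc inv_mult_cancel_left)
  qed
  have \<tau>Z: "\<tau> v \<in> Z" if "v \<in> V" for v
    using C.finprod_closed[of "z v" Q] zZ[OF that] by (auto simp: \<tau>_def)
  have \<tau>_mult: "\<tau> (v \<otimes> w) = \<tau> v \<otimes> \<tau> w" if v: "v \<in> V" and w: "w \<in> V" for v w
  proof -
    have "\<tau> (v \<otimes> w) = finprod (G\<lparr>carrier := Z\<rparr>) (\<lambda>q. z v q \<otimes>\<^bsub>G\<lparr>carrier := Z\<rparr>\<^esub> z w (\<rho> v q)) Q"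
      unfolding \<tau>_def using v w zZ \<rho>Q by (intro C.finprod_cong') (auto simp: z_mult)
    also have "\<dots> = \<tau> v \<otimes> finprod (G\<lparr>carrier := Z\<rparr>) (\<lambda>q. z w (\<rho> v q)) Q"
      unfolding \<tau>_def using v w zZ \<rho>Q by (subst C.finprod_multf) auto
    also have "finprod (G\<lparr>carrier := Z\<rparr>) (\<lambda>q. z w (\<rho> v q)) Q = \<tau> w"
      using C.finprod_reindex[of "z w" "\<rho> v" Q] \<rho>_image[OF v] \<rho>_inj[OF v] zZ[OF w]
      by (auto simp: \<tau>_def)
    finally show ?thesis .
  qed
  have \<tau>_hom: "\<tau> \<in> hom (G\<lparr>carrier := V\<rparr>) (G\<lparr>carrier := Z\<rparr>)"
    using \<tau>Z \<tau>_mult by (auto simp: hom_def)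
  have \<tau>_central: "\<tau> x = x [^] card Q" if x: "x \<in> Z" for x
  proof -
    have xV: "x \<in> V" using x ZV by auto
    have "z x q = x" if q: "q \<in> Q" for q
    proof -
      have "\<rho> x q = q" using cl_Z[OF tV[OF q] x] cl_t[OF q] by (simp add: \<rho>_def)
      moreover have "t q \<otimes> x = x \<otimes> t q" using comm[OF x tV[OF q]] by simp
      ultimately show ?thesis
        using tV[OF q] xV by (simp add: z_def m_assoc)
    qed
    then have "\<tau> x = finprod (G\<lparr>carrier := Z\<rparr>) (\<lambda>q. x) Q"
      unfolding \<tau>_def using x by (intro C.finprod_cong') auto
    then show ?thesis
      using x C.finprod_const[of x Q] by (simp flip: nat_pow_consistent)
  qed
  \<comment> \<open>As \<open>Q\<close> is finite, some power \<open>v^(j - i)\<close> is central,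
    and on central elements \<open>\<tau>\<close> is the \<open>card Q\<close>-th power. This yields
    \<open>m = j - i\<close> and \<open>k = (j - i) * card Q\<close>.\<close>
  have "\<exists>m>0. \<exists>k>0. \<tau> v [^] (m::nat) = v [^] (k::nat)" if v: "v \<in> V" for v
  proof -
    have pV: "v [^] n \<in> V" for n :: nat using v by (induction n) auto
    have "\<not> inj (\<lambda>n::nat. cl (v [^] n))"
    proof
      assume "inj (\<lambda>n::nat. cl (v [^] n))"
      moreover have "range (\<lambda>n::nat. cl (v [^] n)) \<subseteq> Q" using pV by (auto simp: Q_def)
      ultimately show False using finQ by (metis finite_imageD finite_subset infinite_UNIV_nat)
    qed
    then obtain i j :: nat where ij: "i < j" "cl (v [^] j) = cl (v [^] i)"
      unfolding inj_def by (metis linorder_neqE_nat)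
    have "v [^] (j - i) \<otimes> v [^] i = v [^] j"
      using v ij by (simp add: nat_pow_mult)
    then have "v [^] j \<otimes> inv (v [^] i) = v [^] (j - i)"
      using v by (metis V.mem_carrier inv_solve_right nat_pow_closed)
    then have cz: "v [^] (j - i) \<in> Z"
      using cl_eqD[OF pV pV ij(2)] by simp
    have \<tau>p: "\<tau> (v [^] n) = \<tau> v [^] n" for n :: nat
    proof (induction n)
      case 0
      then show ?case using \<tau>_central[OF Z.one_closed] by simp
    next
      case (Suc n)
      then show ?case using \<tau>_mult[OF pV v] by simp
    qed
    have "\<tau> v [^] (j - i) = v [^] ((j - i) * card Q)"
      using \<tau>_central[OF cz] \<tau>p v by (simp add: nat_pow_pow)
    moreover have "card Q > 0"
      using finQ v by (auto simp: card_gt_0_iff Q_def)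
    ultimately show ?thesis using ij(1) by (meson nat_0_less_mult_iff zero_less_diff)
  qed
  then show ?thesis using Z commZ \<tau>_hom unfolding V_def by blast
qed

theorem finite_generate_comm_values:
  assumes S: "\<And>i. i \<in> leaves t \<Longrightarrow> normal_set G (S i) \<and> contains_powers G (S i)"
    and fin: "finite (comm_values G S t)"
  shows "finite (generate G (comm_values G S t))"
proof -
  define F where "F = comm_values G S t"
  have F: "normal_set G F" unfolding F_def using S by (intro normal_set_comm_values) blast
  have finF: "finite F" using fin by (simp add: F_def)
  obtain Z \<tau> where Z: "subgroup Z G" "comm_group (G\<lparr>carrier := Z\<rparr>)"
    and \<tau>: "\<tau> \<in> hom (G\<lparr>carrier := generate G F\<rparr>) (G\<lparr>carrier := Z\<rparr>)"
    and \<tau>_pow: "\<And>v. v \<in> generate G F \<Longrightarrow> \<exists>m>0. \<exists>k>0. \<tau> v [^] (m::nat) = v [^] (k::nat)"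
    using exists_transfer[OF F finF] by blast
  let ?Z = "G\<lparr>carrier := Z\<rparr>"
  interpret C: comm_group ?Z by (rule Z)
  define T where "T = {x \<in> carrier ?Z. \<exists>n>0. x [^]\<^bsub>?Z\<^esub> (n::nat) = \<one>\<^bsub>?Z\<^esub>}"
  have T: "subgroup T ?Z" unfolding T_def by (rule C.torsion_subgroup)
  interpret T: normal T ?Z using T by (simp add: C.normal_iff_subgroup)
  have tf: "torsion_free (?Z Mod T)" by (rule C.torsion_free_quotient[OF T_def])
  have cg: "comm_group (?Z Mod T)" by (rule C.abelian_FactGroup[OF T])
  have "(\<lambda>a. T #>\<^bsub>?Z\<^esub> a) \<circ> \<tau> \<in> hom (G\<lparr>carrier := generate G F\<rparr>) (?Z Mod T)"
    by (rule Group.hom_compose[OF \<tau> T.r_coset_hom_Mod])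
  then have \<phi>: "(\<lambda>a. T #>\<^bsub>?Z\<^esub> \<tau> a) \<in> finite_homs G (?Z Mod T) F"
    using finF by (simp add: finite_homs_def o_def)
  have tor: "\<exists>n>0. f [^] (n::nat) = \<one>" if f: "f \<in> F" for f
  proof -
    have fV: "f \<in> generate G F" using f by (rule generate.incl)
    have fG: "f \<in> carrier G" using f F by (auto simp: normal_set_def)
    have "T #>\<^bsub>?Z\<^esub> \<tau> f = T"
      using finite_hom_comm_values_trivial[OF cg tf S \<phi>[unfolded F_def] f[unfolded F_def]] by simp
    moreover have \<tau>f: "\<tau> f \<in> carrier ?Z" using \<tau> fV by (auto simp: hom_def)
    ultimately have "\<tau> f \<in> T" using C.rcos_self[OF _ T] by metis
    then obtain n where n: "n > 0" "\<tau> f [^] (n::nat) = \<one>"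
      by (auto simp: T_def simp flip: nat_pow_consistent)
    obtain m k where mk: "m > 0" "k > 0" "\<tau> f [^] (m::nat) = f [^] (k::nat)"
      using \<tau>_pow[OF fV] by blast
    have \<tau>G: "\<tau> f \<in> carrier G" using \<tau>f subgroup.subset[OF Z(1)] by auto
    have "f [^] (k * n) = (\<tau> f [^] n) [^] m"
      using fG \<tau>G mk by (simp add: nat_pow_pow mult.commute flip: mk(3) nat_pow_pow[OF fG])
    then have "f [^] (k * n) = \<one>" using n by simp
    then show ?thesis using mk(2) n(1) by (intro exI[of _ "k * n"]) simp
  qed
  then obtain N where N: "\<And>f. f \<in> F \<Longrightarrow> N f > 0 \<and> f [^] (N f :: nat) = \<one>" by metis
  \<comment> \<open>Dietzmann's lemma needs one exponent for all of \<open>F\<close>; the product of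
    the individual ones over the finite set serves.\<close>
  have "f [^] (\<Prod>f\<in>F. N f) = \<one>" if f: "f \<in> F" for f
  proof -
    have "f \<in> carrier G" using f F by (auto simp: normal_set_def)
    moreover have "(\<Prod>f\<in>F. N f) = N f * (\<Prod>f\<in>F - {f}. N f)"
      using finF f by (simp add: prod.remove)
    ultimately show ?thesis using N[OF f] by (simp flip: nat_pow_pow)
  qed
  moreover have "(\<Prod>f\<in>F. N f) > 0" using N finF by (simp add: prod_pos)
  ultimately show ?thesis
    using Dietzmann[OF F finF] by (simp add: F_def)
qed

end

section \<open>Word values\<close>

lemma (in group_hom) hom_word_value:
  assumes "\<And>i. g i \<in> carrier G"
  shows "h (word_value G w g) = word_value H w (\<lambda>i. h (g i))"
proof (induction w)
  case (Cons l w)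
  have "h (letter_value G g l) = letter_value H (\<lambda>i. h (g i)) l"
    using assms by (simp add: letter_value_def)
  then show ?case
    using Cons assms G.word_value_closed[of g w] G.letter_value_closed[of g l]
    by (simp add: word_value_def)
qed (simp add: word_value_def)

section \<open>Exponent sums and the abelianization of the free group\<close>

definition exponent_sum :: "nat \<Rightarrow> word \<Rightarrow> int" where
  "exponent_sum i w = (\<Sum>l\<leftarrow>w. if fst l = i then if snd l then 1 else - 1 else 0)"

text \<open>In an abelian group the letters can be collected by variable. A fixed index set
  \<open>A\<close> in place of \<open>vars w\<close> keeps the products comparable along the
  induction.\<close>

lemma (in comm_group) word_value_eq_finprod:
  assumes g: "\<And>i. g i \<in> carrier G" and A: "finite A" "vars w \<subseteq> A"
  shows "word_value G w g = (\<Otimes>i\<in>A. g i [^] exponent_sum i w)"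
  using A(2)
proof (induction w)
  case Nil
  then show ?case by (simp add: word_value_def exponent_sum_def finprod_one_eqI)
next
  case (Cons l w)
  let ?e = "\<lambda>i. if fst l = i then if snd l then 1 else - 1 else (0::int)"
  have l: "fst l \<in> A" and w: "vars w \<subseteq> A" using Cons.prems by (auto simp: vars_def)
  have "letter_value G g l = (\<Otimes>i\<in>A. if fst l = i then letter_value G g l else \<one>)"
    using finprod_singleton[OF l A(1), of "\<lambda>_. letter_value G g l"] letter_value_closed[of g l] g
    by simp
  also have "\<dots> = (\<Otimes>i\<in>A. g i [^] ?e i)"
    using g by (intro finprod_cong') (auto simp: letter_value_def int_pow_neg)
  finally have "word_value G (l # w) g = (\<Otimes>i\<in>A. g i [^] ?e i) \<otimes> (\<Otimes>i\<in>A. g i [^] exponent_sum i w)"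
    using Cons.IH[OF w] by (simp add: word_value_def)
  also have "\<dots> = (\<Otimes>i\<in>A. g i [^] ?e i \<otimes> g i [^] exponent_sum i w)"
    using g by (intro finprod_multf[symmetric]) auto
  also have "\<dots> = (\<Otimes>i\<in>A. g i [^] exponent_sum i (l # w))"
    using g by (intro finprod_cong') (auto simp: exponent_sum_def int_pow_mult)
  finally show ?case .
qed

text \<open>A word is its own value at the variables, so its image in the abelianization is
  determined by its exponent sums. If they all vanish, the image is trivial and the word lies in the
  derived subgroup.\<close>

lemma non_commutator_word_exponent_sum:
  assumes "non_commutator_word u"
  shows "\<exists>i. exponent_sum i u \<noteq> 0"
proof (rule ccontr)
  assume "\<not> ?thesis"
  then have zero: "exponent_sum i u = 0" for i by simp
  interpret F: group free_group by (rule group_free_group)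
  define D where "D = derived free_group (carrier free_group)"
  have u: "u \<in> carrier free_group" "u \<notin> D"
    using assms by (auto simp: non_commutator_word_def D_def)
  interpret D: normal D free_group
    unfolding D_def by (rule F.derived_self_is_normal)
  interpret Q: comm_group "free_group Mod D"
    unfolding D_def by (rule F.derived_quot_is_comm_group)
  interpret \<pi>: group_hom free_group "free_group Mod D" "\<lambda>a. D #>\<^bsub>free_group\<^esub> a"
    using D.r_coset_hom_Mod by unfold_locales
  have "D #>\<^bsub>free_group\<^esub> u = D #>\<^bsub>free_group\<^esub> (word_value free_group u var)"
    using substitute_var u by (simp add: substitute_def carrier_free_group)
  also have "\<dots> = word_value (free_group Mod D) u (\<lambda>i. D #>\<^bsub>free_group\<^esub> var i)"
    by (rule \<pi>.hom_word_value) (rule var_in_carrier)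
  also have "\<dots> = (\<Otimes>\<^bsub>free_group Mod D\<^esub>i\<in>vars u. (D #>\<^bsub>free_group\<^esub> var i) [^]\<^bsub>free_group Mod D\<^esub> exponent_sum i u)"
    by (rule Q.word_value_eq_finprod) (auto simp: vars_def intro!: \<pi>.hom_closed var_in_carrier)
  also have "\<dots> = \<one>\<^bsub>free_group Mod D\<^esub>"
    by (rule Q.finprod_one_eqI) (simp add: zero)
  finally have "D #>\<^bsub>free_group\<^esub> u = D" by simp
  then show False
    using u F.rcos_self[OF u(1) D.is_subgroup] by auto
qed

section \<open>Lower central and derived words as commutator trees\<close>

fun comm_value :: "('a, 'b) monoid_scheme \<Rightarrow> comm_tree \<Rightarrow> (nat \<Rightarrow> 'a) \<Rightarrow> 'a" where
  "comm_value G (Leaf i) g = g i"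
| "comm_value G (Node s t) g = commutator G (comm_value G s g) (comm_value G t g)"

fun disjoint_leaves :: "comm_tree \<Rightarrow> bool" where
  "disjoint_leaves (Leaf i) \<longleftrightarrow> True"
| "disjoint_leaves (Node s t) \<longleftrightarrow>
     disjoint_leaves s \<and> disjoint_leaves t \<and> leaves s \<inter> leaves t = {}"

text \<open>The index is shifted by one: tree \<open>n\<close> has the leaves \<open>0\<close> to
  \<open>n\<close> and represents \<open>lower_central_word (Suc n)\<close>.\<close>

fun lower_central_tree :: "nat \<Rightarrow> comm_tree" where
  "lower_central_tree 0 = Leaf 0"
| "lower_central_tree (Suc n) = Node (lower_central_tree n) (Leaf (Suc n))"

text \<open>The parameter \<open>m\<close> is the first leaf; moving it replaces the renaming of
  variables in \<open>derived_word\<close>.\<close>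

fun derived_tree :: "nat \<Rightarrow> nat \<Rightarrow> comm_tree" where
  "derived_tree 0 m = Leaf m"
| "derived_tree (Suc k) m = Node (derived_tree k m) (derived_tree k (m + 2 ^ k))"

lemma leaves_lower_central_tree: "leaves (lower_central_tree n) = {..n}"
  by (induction n) (simp_all add: atMost_Suc)

lemma disjoint_leaves_lower_central_tree: "disjoint_leaves (lower_central_tree n)"
  by (induction n) (auto simp: leaves_lower_central_tree)

lemma leaves_derived_tree: "leaves (derived_tree k m) = {m..<m + 2 ^ k}"
  by (induction k arbitrary: m) (simp_all add: ivl_disj_un_two add.assoc mult_2)

lemma disjoint_leaves_derived_tree: "disjoint_leaves (derived_tree k m)"
  by (induction k arbitrary: m) (auto simp: leaves_derived_tree)

lemma comm_value_cong:
  "(\<And>i. i \<in> leaves t \<Longrightarrow> g i = h i) \<Longrightarrow> comm_value G t g = comm_value G t h"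
  by (induction t) auto

lemma comm_value_derived_tree_shift:
  "comm_value G (derived_tree k m) (\<lambda>i. g (n + i)) = comm_value G (derived_tree k (n + m)) g"
  by (induction k arbitrary: m) (auto simp: add.assoc)

section \<open>Word values in a group\<close>

context group
begin

lemma group_hom_word_value:
  "(\<And>i. g i \<in> carrier G) \<Longrightarrow> group_hom free_group G (\<lambda>w. word_value G w g)"
  by (simp add: group_hom_def group_hom_axioms_def group_free_group word_value_hom)

lemma word_value_substitute:
  assumes "\<And>i. u i \<in> carrier free_group" "\<And>i. g i \<in> carrier G"
  shows "word_value G (substitute w u) g = word_value G w (\<lambda>i. word_value G (u i) g)"
  unfolding substitute_def using group_hom.hom_word_value[OF group_hom_word_value] assms by blast

lemma word_value_commutator:
  assumes g: "\<And>i. g i \<in> carrier G" and "v \<in> carrier free_group" "w \<in> carrier free_group"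
  shows "word_value G (commutator free_group v w) g =
           commutator G (word_value G v g) (word_value G w g)"
proof -
  interpret h: group_hom free_group G "\<lambda>w. word_value G w g"
    using g by (rule group_hom_word_value)
  show ?thesis using assms by (simp add: commutator_def)
qed

lemma word_value_lower_central_word:
  assumes "\<And>i. g i \<in> carrier G"
  shows "word_value G (lower_central_word (Suc n)) g = comm_value G (lower_central_tree n) g"
  using assms
  by (induction n)
     (simp_all add: word_value_var word_value_commutator var_in_carrier lower_central_word_closed)

lemma word_value_derived_word:
  assumes "\<And>i. g i \<in> carrier G"
  shows "word_value G (derived_word k) g = comm_value G (derived_tree k 0) g"
  using assms
proof (induction k arbitrary: g)
  case (Suc k)
  have "substitute (derived_word k) (\<lambda>i. var (2 ^ k + i)) \<in> carrier free_group"
    by (intro substitute_closed var_in_carrier)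
  then show ?case
    using Suc comm_value_derived_tree_shift[of G k 0 g "2 ^ k"]
    by (simp add: word_value_commutator derived_word_closed word_value_substitute
        var_in_carrier word_value_var)
qed (simp add: word_value_var)

lemma conj_by_word_value:
  assumes "\<And>i. g i \<in> carrier G" "a \<in> carrier G"
  shows "conj_by G a (word_value G w g) = word_value G w (\<lambda>i. conj_by G a (g i))"
proof -
  interpret c: group_hom G G "conj_by G a"
    by unfold_locales (use assms in \<open>simp add: hom_def conj_by_mult\<close>)
  show ?thesis using assms by (intro c.hom_word_value)
qed

lemma normal_set_word_values: "normal_set G (word_values G w)"
  by (rule normal_setI) (force simp: word_values_def conj_by_word_value word_value_closed)+

text \<open>Exponent sums may be negative; in that case the \<open>n\<close>-th power of
  \<open>inv g\<close> is a positive power of \<open>g\<close>.\<close>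

lemma contains_powersI:
  assumes n: "n \<noteq> 0" and X: "\<And>g. g \<in> carrier G \<Longrightarrow> g [^] (n::int) \<in> X"
  shows "contains_powers G X"
  unfolding contains_powers_def
proof (intro exI conjI ballI)
  show "nat \<bar>n\<bar> > 0" using n by simp
  fix g assume g: "g \<in> carrier G"
  show "g [^] nat \<bar>n\<bar> \<in> X"
  proof (cases "n > 0")
    case True
    then show ?thesis using X[OF g] by (simp add: pow_nat)
  next
    case False
    then show ?thesis using X[of "inv g"] g by (simp add: pow_nat int_pow_inv int_pow_neg)
  qed
qed

text \<open>Some variable has non-zero exponent sum. Setting all others to the identity leaves that
  power of its value.\<close>

lemma contains_powers_word_values:
  assumes "non_commutator_word u"
  shows "contains_powers G (word_values G u)"
proof -
  obtain i where i: "exponent_sum i u \<noteq> 0"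
    using non_commutator_word_exponent_sum[OF assms] by blast
  have "word_value G w (\<lambda>j. if j = i then g else \<one>) = g [^] exponent_sum i w" if "g \<in> carrier G" for g w
    using that
  proof (induction w)
    case (Cons l w)
    then show ?case
      by (auto simp: word_value_def exponent_sum_def letter_value_def int_pow_mult int_pow_neg)
  qed (simp add: word_value_def exponent_sum_def)
  then have "g [^] exponent_sum i u \<in> word_values G u" if "g \<in> carrier G" for g
    unfolding word_values_def using that by (force intro!: exI[of _ "\<lambda>j. if j = i then g else \<one>"])
  then show ?thesis using i by (intro contains_powersI)
qed

text \<open>Because words at distinct leaves share no variables, assignments chosen separately for
  the branches merge into a single one.\<close>

lemma comm_values_word_values:
  assumes "disjoint_leaves t" "disjoint_family_on (\<lambda>i. vars (u i)) (leaves t)"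
  shows "comm_values G (\<lambda>i. word_values G (u i)) t =
           {comm_value G t (\<lambda>i. word_value G (u i) g) | g. \<forall>i. g i \<in> carrier G}"
  using assms
proof (induction t)
  case (Leaf i)
  then show ?case by (auto simp: word_values_def)
next
  case (Node s t)
  let ?w = "\<lambda>g i. word_value G (u i) g"
  have disj: "vars (u i) \<inter> vars (u j) = {}" if "i \<in> leaves s" "j \<in> leaves t" for i j
  proof -
    have "i \<noteq> j" using Node.prems(1) that by auto
    then show ?thesis using Node.prems(2) that by (simp add: disjoint_family_on_def)
  qed
  have IH: "comm_values G (\<lambda>i. word_values G (u i)) s = {comm_value G s (?w g) | g. \<forall>i. g i \<in> carrier G}"
    "comm_values G (\<lambda>i. word_values G (u i)) t = {comm_value G t (?w g) | g. \<forall>i. g i \<in> carrier G}"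
    using Node.prems by (intro Node.IH; simp add: disjoint_family_on_def)+
  have combine: "\<exists>k. (\<forall>i. k i \<in> carrier G) \<and> comm_value G s (?w g) = comm_value G s (?w k) \<and>
          comm_value G t (?w h) = comm_value G t (?w k)"
    if g: "\<forall>i. g i \<in> carrier G" and h: "\<forall>i. h i \<in> carrier G" for g h
  proof -
    define k where "k j = (if j \<in> (\<Union>i\<in>leaves s. vars (u i)) then g j else h j)" for j
    have "?w g i = ?w k i" if "i \<in> leaves s" for i
      using that by (intro word_value_cong) (auto simp: k_def)
    then have "comm_value G s (?w g) = comm_value G s (?w k)"
      by (rule comm_value_cong)
    moreover have "?w h i = ?w k i" if i: "i \<in> leaves t" for i
    proof (rule word_value_cong)
      fix j assume "j \<in> vars (u i)"
      then have "j \<notin> (\<Union>i\<in>leaves s. vars (u i))" using disj[OF _ i] by blast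
      then show "h j = k j" by (simp add: k_def)
    qed
    then have "comm_value G t (?w h) = comm_value G t (?w k)"
      by (rule comm_value_cong)
    moreover have "\<forall>i. k i \<in> carrier G" using g h by (simp add: k_def)
    ultimately show ?thesis by blast
  qed
  show ?case
  proof (intro equalityI subsetI)
    fix z assume "z \<in> comm_values G (\<lambda>i. word_values G (u i)) (Node s t)"
    then obtain g h where gh: "\<forall>i. g i \<in> carrier G" "\<forall>i. h i \<in> carrier G"
      "z = commutator G (comm_value G s (?w g)) (comm_value G t (?w h))"
      by (auto simp: IH)
    then obtain k where "\<forall>i. k i \<in> carrier G" "z = comm_value G (Node s t) (?w k)"
      using combine[OF gh(1,2)] by (metis comm_value.simps(2))
    then show "z \<in> {comm_value G (Node s t) (?w g) | g. \<forall>i. g i \<in> carrier G}" by blast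
  next
    fix z assume "z \<in> {comm_value G (Node s t) (?w g) | g. \<forall>i. g i \<in> carrier G}"
    then obtain g where g: "\<forall>i. g i \<in> carrier G" "z = comm_value G (Node s t) (?w g)" by blast
    then have "comm_value G s (?w g) \<in> comm_values G (\<lambda>i. word_values G (u i)) s"
      "comm_value G t (?w g) \<in> comm_values G (\<lambda>i. word_values G (u i)) t"
      unfolding IH using g(1) by blast+
    then show "z \<in> comm_values G (\<lambda>i. word_values G (u i)) (Node s t)"
      unfolding g(2) comm_value.simps comm_values.simps by blast
  qed
qed

end

text \<open>The common core of both assertions and both families of words. Asking for
  \<open>contains_powers\<close> lets powers of variables enter directly, without first proving that
  they are non-commutator words.\<close>

lemma concise_substitute:
  fixes w :: word
  assumes w: "\<And>(G :: 'a monoid) g. group G \<Longrightarrow> (\<And>i. g i \<in> carrier G) \<Longrightarrow>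
                word_value G w g = comm_value G t g"
    and t: "disjoint_leaves t" "leaves t \<subseteq> {..<r}" and vars: "vars w \<subseteq> {..<r}"
    and u: "\<And>i. i < r \<Longrightarrow> u i \<in> carrier free_group" "disjoint_family_on (\<lambda>i. vars (u i)) {..<r}"
    and pow: "\<And>i (G :: 'a monoid). i < r \<Longrightarrow> group G \<Longrightarrow> contains_powers G (word_values G (u i))"
  shows "concise TYPE('a) (substitute w u)"
  unfolding concise_def
proof (intro allI impI)
  fix G :: "'a monoid" assume "group G" and fin: "finite (word_values G (substitute w u))"
  interpret group G by fact
  \<comment> \<open>Outside the indices below \<open>r\<close> nothing is known about
    \<open>u\<close>, not even that its words are reduced. The empty word is a safe default there,
    and \<open>w\<close> does not see the change.\<close>
  define u' where "u' i = (if i < r then u i else \<one>\<^bsub>free_group\<^esub>)" for i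
  interpret F: group free_group by (rule group_free_group)
  have sub: "substitute w u = substitute w u'"
    unfolding substitute_def using vars by (intro word_value_cong) (auto simp: u'_def)
  have "disjoint_family_on (\<lambda>i. vars (u' i)) (leaves t)"
    using u(2) t(2) by (auto simp: disjoint_family_on_def u'_def subset_iff)
  note comm_values_word_values[OF t(1) this]
  moreover have "word_value G (substitute w u') g = comm_value G t (\<lambda>i. word_value G (u' i) g)"
    if "\<forall>i. g i \<in> carrier G" for g
    using that u(1) by (subst word_value_substitute) (auto simp: u'_def w \<open>group G\<close> word_value_closed)
  ultimately have eq: "word_values G (substitute w u) = comm_values G (\<lambda>i. word_values G (u' i)) t"
    unfolding sub word_values_def[of G "substitute w u'"] by (simp cong: rev_conj_cong)
  have "finite (generate G (comm_values G (\<lambda>i. word_values G (u' i)) t))"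
    using fin t(2) pow[OF _ \<open>group G\<close>] unfolding eq
    by (intro finite_generate_comm_values conjI normal_set_word_values) (auto simp: u'_def)
  then show "finite (verbal_subgroup G (substitute w u))"
    by (simp add: verbal_subgroup_def eq)
qed

section \<open>Powers of variables\<close>

lemma vars_var_int_pow: "vars (var i [^]\<^bsub>free_group\<^esub> (n::int)) \<subseteq> {i}"
proof -
  interpret F: group free_group by (rule group_free_group)
  have "vars (var i [^]\<^bsub>free_group\<^esub> k) \<subseteq> {i}" for k :: nat
  proof (induction k)
    case (Suc k)
    moreover have "vars (var i) = {i}" by (simp add: vars_def var_def)
    ultimately show ?case using vars_mult by fastforce
  qed (simp add: one_free_group vars_def)
  moreover have "vars (inv\<^bsub>free_group\<^esub> (var i [^]\<^bsub>free_group\<^esub> k)) = vars (var i [^]\<^bsub>free_group\<^esub> k)"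
    for k :: nat
    by (intro vars_inv F.nat_pow_closed var_in_carrier)
  ultimately show ?thesis
    unfolding int_pow_def2 by presburger
qed

lemma (in group) contains_powers_word_values_var_int_pow:
  assumes "n \<noteq> 0"
  shows "contains_powers G (word_values G (var i [^]\<^bsub>free_group\<^esub> (n::int)))"
proof (rule contains_powersI[OF assms])
  fix g assume g: "g \<in> carrier G"
  interpret h: group_hom free_group G "\<lambda>w. word_value G w (\<lambda>_. g)"
    using g by (intro group_hom_word_value)
  have "word_value G (var i [^]\<^bsub>free_group\<^esub> n) (\<lambda>_. g) = g [^] n"
    using g by (simp add: h.hom_int_pow var_in_carrier word_value_var)
  then show "g [^] n \<in> word_values G (var i [^]\<^bsub>free_group\<^esub> n)"
    using g by (force simp: word_values_def)
qed

theorem theoremA: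
  fixes w :: word and r :: nat
  assumes "(r \<ge> 1 \<and> w = lower_central_word r) \<or> (\<exists>k. r = 2 ^ k \<and> w = derived_word k)"
  shows "(\<forall>u :: nat \<Rightarrow> word.
            (\<forall>i<r. non_commutator_word (u i)) \<longrightarrow>
            disjoint_family_on (\<lambda>i. vars (u i)) {..<r} \<longrightarrow>
            concise TYPE('a) (substitute w u)) \<and>
         (\<forall>n :: nat \<Rightarrow> int.
            (\<forall>i<r. n i \<noteq> 0) \<longrightarrow>
            concise TYPE('a) (substitute w (\<lambda>i. var i [^]\<^bsub>free_group\<^esub> n i)))"
proof -
  interpret F: group free_group by (rule group_free_group)
  \<comment> \<open>From here on the two families are treated alike: only a tree that evaluates to
    \<open>w\<close> and has its leaves below \<open>r\<close> is used.\<close>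
  obtain t where t: "disjoint_leaves t" "leaves t \<subseteq> {..<r}" "vars w \<subseteq> {..<r}"
    and w: "\<And>(G :: 'a monoid) g. group G \<Longrightarrow> (\<And>i. g i \<in> carrier G) \<Longrightarrow>
              word_value G w g = comm_value G t g"
    using assms
  proof (elim disjE conjE exE)
    assume r: "r \<ge> 1" "w = lower_central_word r"
    then obtain n where n: "r = Suc n" by (cases r) auto
    show thesis
      by (rule that[of "lower_central_tree n"])
         (use r n vars_lower_central_word[of r] in \<open>auto simp: disjoint_leaves_lower_central_tree
            leaves_lower_central_tree group.word_value_lower_central_word\<close>)
  next
    fix k assume k: "r = 2 ^ k" "w = derived_word k"
    show thesis
      by (rule that[of "derived_tree k 0"])
         (use k vars_derived_word[of k] in \<open>auto simp: disjoint_leaves_derived_tree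
            leaves_derived_tree group.word_value_derived_word\<close>)
  qed
  show ?thesis
  proof (intro conjI allI impI)
    fix u :: "nat \<Rightarrow> word"
    assume "\<forall>i<r. non_commutator_word (u i)" "disjoint_family_on (\<lambda>i. vars (u i)) {..<r}"
    then show "concise TYPE('a) (substitute w u)"
      by (intro concise_substitute[OF w t] group.contains_powers_word_values)
         (auto simp: non_commutator_word_def)
  next
    fix n :: "nat \<Rightarrow> int" assume n: "\<forall>i<r. n i \<noteq> 0"
    have "disjoint_family_on (\<lambda>i. vars (var i [^]\<^bsub>free_group\<^esub> n i)) {..<r}"
      unfolding disjoint_family_on_def using vars_var_int_pow by blast
    then show "concise TYPE('a) (substitute w (\<lambda>i. var i [^]\<^bsub>free_group\<^esub> n i))"
      using n by (intro concise_substitute[OF w t] group.contains_powers_word_values_var_int_pow)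
        (auto simp: var_in_carrier)
  qed
qed

end
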